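(* Let $A=\mathrm{diag}\{a_1,\dots,a_n\}$, $C_0=\mathrm{diag}\{c_1,\dots,c_n\}$, $\bar B=\mathrm{diag}\{\bar b_1,\dots,\bar b_n\}$, $\bar C=\mathrm{diag}\{\bar c_1,\dots,\bar c_n\}$ be real diagonal matrices, with $A$ invertible, $\bar b_j\ne0$ for all $j\in\{1,\dots,n\}$, and $a_i^2\ge1$ for at least one $i$. For an integer $D\ge0$, let $[A,C_0;\bar B,\bar C]_D$ denote the system $$x_{t+1}=Ax_t+\omega_t^0C_0u_t+(\bar B+\omega_t^D\bar C)u_{t-D},\qquad t\ge0,$$ and let $U_A=\{a_i: a_i^2\ge1,\ 1\le i\le n\}$ be the set of unstable eigenvalues of $A$. Then $[A,C_0;\bar B,\bar C]_D$ is asymptotically mean-square stabilizable if and only if $0\le D<D_{\max}$, where the delay margin $D_{\max}$ satisfies: a) If $a_i^2=1$ for each $a_i\in U_A$, then $D_{\max}=+\infty$. b) If for each $a_i\in U_A$, $a_i^2<\dfrac{\bar b_i^2}{\sigma_0^2c_i^2+\sigma_D^2\bar c_i^2}+1$, and there exists $a_j\in U_A$ such that $a_j^2>1$, then $$D_{\max}=\min_{a_i\in U_A,\ a_i^2>1}\frac{\ln(\bar b_i^2)-\ln(\sigma_0^2c_i^2+\sigma_D^2\bar c_i^2)-\ln(a_i^2-1)}{\ln(a_i^2)}.$$ c) If there exists $a_i\in U_A$ satisfying $a_i^2\ge\dfrac{\bar b_i^2}{\sigma_0^2c_i^2+\sigma_D^2\bar c_i^2}+1$, then $D_{\max}=0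$.
   Context: Primes denote transposes and $\mathbf{E}$ denotes expectation. $x_t\in\mathbb{R}^n$ is the state and $u_t\in\mathbb{R}^n$ the control input; the initial data $x_0$ and $u_t$, $t=-D,\dots,-1$, are given a priori (deterministic). Conditions and minima "over $a_i\in U_A$" range over all indices $i$ with $a_i^2\ge1$. If $\sigma_0^2c_i^2+\sigma_D^2\bar c_i^2=0$, the quotient $\bar b_i^2/(\sigma_0^2c_i^2+\sigma_D^2\bar c_i^2)$ is read as $+\infty$ and $\ln 0$ as $-\infty$. Noise: $\{\omega_t^0\}_{t\ge 0}$ and $\{\omega_t^D\}_{t\ge 0}$ are two mutually independent real random sequences, each independent and identically distributed in time, with zero mean and $\mathbf{E}(\omega_t^0\omega_s^0)=\sigma_0^2\delta_{ts}$, $\mathbf{E}(\omega_t^D\omega_s^D)=\sigma_D^2\delta_{ts}$ ($\delta_{ts}$ the Kronecker delta). The superscript $D$ labels the noise channel attached to the delayed input; the variances $\sigma_0^2,\sigma_D^2$ are fixed numbers not varying with the delay $D$, and the two channels are distinct also when $D=0$. $\mathcal{F}_t$ is the $\sigma$-algebra generated by both noises at times $0,\dots,t$. Admissible controls: $\mathcal{U}_{ad}$ is the set of control processes $u$ such that $u_t$ is $\mathcal{F}_t$-measurable, $\sum_{t=0}^\infty\mathbf{E}(u_t'u_t)<\infty$, and $u_t=K_0x_t+\sum_{\tau=1}^DK_\tau u_{t-\tau}$ for all $t\ge 0$, for some constant matrices $K_0,\dots,K_D$ of compatible dimensions. Stabilizability: the system is asymptotically mean-square stabilizable if there exists a feedback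 control law (constant gains $K_0,\dots,K_D$) in $\mathcal{U}_{ad}$ such that the closed-loop system satisfies $\lim_{t\to\infty}\mathbf{E}(x_t'x_t)=0$ for any initial values $x_0$ and $u_t$, $t=-D,\dots,-1$. *)

theory Defs
  imports "HOL-Probability.Probability"
begin

definition diag_mat :: "real ^ 'n \<Rightarrow> real ^ 'n ^ 'n" where
  "diag_mat v = (\<chi> i j. if i = j then v $ i else 0)"

definition iid_noise :: "'w measure \<Rightarrow> (nat \<Rightarrow> 'w \<Rightarrow> real) \<Rightarrow> real \<Rightarrow> bool" where
  "iid_noise M w \<sigma> \<longleftrightarrow>
     prob_space.indep_vars M (\<lambda>_. borel) w UNIV \<and>
     (\<forall>t. distr M borel (w t) = distr M borel (w 0)) \<and>
     (\<forall>t. integrable M (w t) \<and> prob_space.expectation M (w t) = 0) \<and>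
     (\<forall>t s. integrable M (\<lambda>\<omega>. w t \<omega> * w s \<omega>) \<and>
        prob_space.expectation M (\<lambda>\<omega>. w t \<omega> * w s \<omega>) = (if t = s then \<sigma>\<^sup>2 else 0))"

definition independent_sequences ::
    "'w measure \<Rightarrow> (nat \<Rightarrow> 'w \<Rightarrow> real) \<Rightarrow> (nat \<Rightarrow> 'w \<Rightarrow> real) \<Rightarrow> bool" where
  "independent_sequences M v w \<longleftrightarrow>
     prob_space.indep_var M (PiM UNIV (\<lambda>_. borel)) (\<lambda>\<omega> t. v t \<omega>) (PiM UNIV (\<lambda>_. borel)) (\<lambda>\<omega> t. w t \<omega>)"

definition noise_filtration ::
    "'w measure \<Rightarrow> (nat \<Rightarrow> 'w \<Rightarrow> real) \<Rightarrow> (nat \<Rightarrow> 'w \<Rightarrow> real) \<Rightarrow> nat \<Rightarrow> 'w measure" where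
  "noise_filtration M w0 wD t =
     sigma (space M) (\<Union>s\<le>t. {w0 s -` S \<inter> space M | S. S \<in> sets borel} \<union>
                              {wD s -` S \<inter> space M | S. S \<in> sets borel})"

(* The input u is indexed by int, so that u (- D), ..., u (- 1) is the deterministic initial
   segment given by \<phi>; values of u and \<phi> at other negative times are irrelevant. *)

definition state_equation ::
    "'w measure \<Rightarrow> (nat \<Rightarrow> 'w \<Rightarrow> real) \<Rightarrow> (nat \<Rightarrow> 'w \<Rightarrow> real) \<Rightarrow>
     real ^ 'n ^ 'n \<Rightarrow> real ^ 'n ^ 'n \<Rightarrow> real ^ 'n ^ 'n \<Rightarrow> real ^ 'n ^ 'n \<Rightarrow> nat \<Rightarrow>
     (nat \<Rightarrow> 'w \<Rightarrow> real ^ 'n) \<Rightarrow> (int \<Rightarrow> 'w \<Rightarrow> real ^ 'n) \<Rightarrow> bool" where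
  "state_equation M w0 wD A C0 B C D x u \<longleftrightarrow>
     (\<forall>t. \<forall>\<omega>\<in>space M. x (Suc t) \<omega> =
        A *v x t \<omega> + w0 t \<omega> *\<^sub>R (C0 *v u (int t) \<omega>)
        + (B + wD t \<omega> *\<^sub>R C) *v u (int t - int D) \<omega>)"

definition initial_data ::
    "'w measure \<Rightarrow> nat \<Rightarrow> real ^ 'n \<Rightarrow> (int \<Rightarrow> real ^ 'n) \<Rightarrow>
     (nat \<Rightarrow> 'w \<Rightarrow> real ^ 'n) \<Rightarrow> (int \<Rightarrow> 'w \<Rightarrow> real ^ 'n) \<Rightarrow> bool" where
  "initial_data M D x0 \<phi> x u \<longleftrightarrow>
     (\<forall>\<omega>\<in>space M. x 0 \<omega> = x0 \<and> (\<forall>s\<in>{- int D..-1}. u s \<omega> = \<phi> s))"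

definition feedback_law ::
    "'w measure \<Rightarrow> nat \<Rightarrow> (nat \<Rightarrow> real ^ 'n ^ 'n) \<Rightarrow>
     (nat \<Rightarrow> 'w \<Rightarrow> real ^ 'n) \<Rightarrow> (int \<Rightarrow> 'w \<Rightarrow> real ^ 'n) \<Rightarrow> bool" where
  "feedback_law M D K x u \<longleftrightarrow>
     (\<forall>t. \<forall>\<omega>\<in>space M.
        u (int t) \<omega> = K 0 *v x t \<omega> + (\<Sum>\<tau>=1..D. K \<tau> *v u (int t - int \<tau>) \<omega>))"

definition admissible ::
    "'w measure \<Rightarrow> (nat \<Rightarrow> 'w \<Rightarrow> real) \<Rightarrow> (nat \<Rightarrow> 'w \<Rightarrow> real) \<Rightarrow> nat \<Rightarrow>
     (nat \<Rightarrow> 'w \<Rightarrow> real ^ 'n) \<Rightarrow> (int \<Rightarrow> 'w \<Rightarrow> real ^ 'n) \<Rightarrow> bool" where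
  "admissible M w0 wD D x u \<longleftrightarrow>
     (\<forall>t. u (int t) \<in> borel_measurable (noise_filtration M w0 wD t)) \<and>
     (\<forall>t. integrable M (\<lambda>\<omega>. u (int t) \<omega> \<bullet> u (int t) \<omega>)) \<and>
     summable (\<lambda>t. prob_space.expectation M (\<lambda>\<omega>. u (int t) \<omega> \<bullet> u (int t) \<omega>)) \<and>
     (\<exists>K. feedback_law M D K x u)"

(* The trajectory (x, u) is determined by x0, \<phi> and K; see closed_loop_exists and
   closed_loop_unique below. *)
definition closed_loop ::
    "'w measure \<Rightarrow> (nat \<Rightarrow> 'w \<Rightarrow> real) \<Rightarrow> (nat \<Rightarrow> 'w \<Rightarrow> real) \<Rightarrow>
     real ^ 'n ^ 'n \<Rightarrow> real ^ 'n ^ 'n \<Rightarrow> real ^ 'n ^ 'n \<Rightarrow> real ^ 'n ^ 'n \<Rightarrow> nat \<Rightarrow>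
     (nat \<Rightarrow> real ^ 'n ^ 'n) \<Rightarrow> real ^ 'n \<Rightarrow> (int \<Rightarrow> real ^ 'n) \<Rightarrow>
     (nat \<Rightarrow> 'w \<Rightarrow> real ^ 'n) \<Rightarrow> (int \<Rightarrow> 'w \<Rightarrow> real ^ 'n) \<Rightarrow> bool" where
  "closed_loop M w0 wD A C0 B C D K x0 \<phi> x u \<longleftrightarrow>
     initial_data M D x0 \<phi> x u \<and> state_equation M w0 wD A C0 B C D x u \<and>
     feedback_law M D K x u"

definition ms_stabilizable ::
    "'w measure \<Rightarrow> (nat \<Rightarrow> 'w \<Rightarrow> real) \<Rightarrow> (nat \<Rightarrow> 'w \<Rightarrow> real) \<Rightarrow>
     real ^ 'n ^ 'n \<Rightarrow> real ^ 'n ^ 'n \<Rightarrow> real ^ 'n ^ 'n \<Rightarrow> real ^ 'n ^ 'n \<Rightarrow> nat \<Rightarrow> bool" where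
  "ms_stabilizable M w0 wD A C0 B C D \<longleftrightarrow>
     (\<exists>K. \<forall>x0 \<phi> x u. closed_loop M w0 wD A C0 B C D K x0 \<phi> x u \<longrightarrow>
        admissible M w0 wD D x u \<and>
        (\<forall>t. integrable M (\<lambda>\<omega>. x t \<omega> \<bullet> x t \<omega>)) \<and>
        (\<lambda>t. prob_space.expectation M (\<lambda>\<omega>. x t \<omega> \<bullet> x t \<omega>)) \<longlonglongrightarrow> 0)"

lemma closed_loop_exists:
  fixes A C0 B C :: "real ^ 'n ^ 'n"
  shows "\<exists>x u. closed_loop M w0 wD A C0 B C D K x0 \<phi> x u"
proof -
  (* h t = (x t, p) where p k = u (t - k) for k >= 1 *)
  define v where "v = (\<lambda>(y :: real ^ 'n, p :: nat \<Rightarrow> real ^ 'n).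
    K 0 *v y + (\<Sum>\<tau>=1..D. K \<tau> *v p \<tau>))"
  define h where "h = (\<lambda>\<omega>. rec_nat (x0, \<lambda>k. \<phi> (- int k)) (\<lambda>t s.
     (A *v fst s + w0 t \<omega> *\<^sub>R (C0 *v v s)
        + (B + wD t \<omega> *\<^sub>R C) *v (if D = 0 then v s else snd s D),
      \<lambda>k. if k = 1 then v s else snd s (k - 1))))"
  define x where "x = (\<lambda>t \<omega>. fst (h \<omega> t))"
  define u where "u = (\<lambda>s \<omega>. if 0 \<le> s then v (h \<omega> (nat s)) else \<phi> s)"
  have past: "snd (h \<omega> t) k = u (int t - int k) \<omega>" if "k \<ge> 1" for \<omega> t k
    using that
  proof (induction t arbitrary: k)
    case 0
    then show ?case by (simp add: h_def u_def)
  next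
    case (Suc t)
    show ?case
    proof (cases "k = 1")
      case True
      then show ?thesis by (simp add: h_def u_def)
    next
      case False
      with Suc.prems have "k - 1 \<ge> 1" by simp
      have "snd (h \<omega> (Suc t)) k = snd (h \<omega> t) (k - 1)"
        using False by (simp add: h_def)
      also have "\<dots> = u (int t - int (k - 1)) \<omega>"
        using Suc.IH[OF \<open>k - 1 \<ge> 1\<close>] .
      also have "int t - int (k - 1) = int (Suc t) - int k"
        using Suc.prems by simp
      finally show ?thesis .
    qed
  qed
  have now: "u (int t) \<omega> = v (h \<omega> t)" for t \<omega>
    by (simp add: u_def)
  have "initial_data M D x0 \<phi> x u"
    by (simp add: initial_data_def x_def u_def h_def)
  moreover have "feedback_law M D K x u"
    unfolding feedback_law_def now by (simp add: v_def x_def past case_prod_unfold)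
  moreover have "state_equation M w0 wD A C0 B C D x u"
    unfolding state_equation_def
  proof (intro allI ballI)
    fix t \<omega>
    have del: "(if D = 0 then v (h \<omega> t) else snd (h \<omega> t) D) = u (int t - int D) \<omega>"
      using past[of D \<omega> t] now[of t \<omega>] by auto
    have "x (Suc t) \<omega> = A *v x t \<omega> + w0 t \<omega> *\<^sub>R (C0 *v v (h \<omega> t))
      + (B + wD t \<omega> *\<^sub>R C) *v (if D = 0 then v (h \<omega> t) else snd (h \<omega> t) D)"
      by (simp add: x_def h_def)
    then show "x (Suc t) \<omega> = A *v x t \<omega> + w0 t \<omega> *\<^sub>R (C0 *v u (int t) \<omega>)
      + (B + wD t \<omega> *\<^sub>R C) *v u (int t - int D) \<omega>"
      unfolding del now .
  qed
  ultimately show ?thesis unfolding closed_loop_def by blast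
qed

lemma closed_loop_unique:
  assumes 1: "closed_loop M w0 wD A C0 B C D K x0 \<phi> x u"
    and 2: "closed_loop M w0 wD A C0 B C D K x0 \<phi> y v"
    and \<omega>: "\<omega> \<in> space M"
  shows "x t \<omega> = y t \<omega> \<and> u (int t) \<omega> = v (int t) \<omega>"
proof (induction t rule: less_induct)
  case (less t)
  have past: "u s \<omega> = v s \<omega>" if "- int D \<le> s" "s < int t" for s
  proof (cases "s < 0")
    case True
    then show ?thesis
      using 1 2 \<omega> that by (simp add: closed_loop_def initial_data_def)
  next
    case False
    then have "nat s < t" "s = int (nat s)" using that by auto
    then show ?thesis using less by metis
  qed
  have x: "x t \<omega> = y t \<omega>"
  proof (cases t)
    case 0
    then show ?thesis using 1 2 \<omega> by (simp add: closed_loop_def initial_data_def)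
  next
    case (Suc r)
    have "u (int r) \<omega> = v (int r) \<omega>" "u (int r - int D) \<omega> = v (int r - int D) \<omega>"
      "x r \<omega> = y r \<omega>"
      using past Suc less by auto
    then show ?thesis
      using 1 2 \<omega> Suc by (simp add: closed_loop_def state_equation_def)
  qed
  have "(\<Sum>\<tau>=1..D. K \<tau> *v u (int t - int \<tau>) \<omega>) = (\<Sum>\<tau>=1..D. K \<tau> *v v (int t - int \<tau>) \<omega>)"
    by (rule sum.cong) (auto simp: past)
  then show ?case
    using 1 2 \<omega> x by (simp add: closed_loop_def feedback_law_def)
qed

(* Extended logarithm for nonnegative arguments, with ln 0 = -\<infinity>. *)
definition eln :: "real \<Rightarrow> ereal" where
  "eln r = (if r = 0 then -\<infinity> else ereal (ln r))"

(* The unstable eigenvalues of diag a, represented by their indices. *)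
definition unstable :: "real ^ 'n \<Rightarrow> 'n set" where
  "unstable a = {i. (a $ i)\<^sup>2 \<ge> 1}"

end

theory Submission
  imports Defs
begin

text \<open>
  Since all plant matrices are diagonal, the \<open>i\<close>-th coordinates of state and input form a scalar
  system of their own, whatever gain matrices \<open>K\<close> are used; only the feedback law may couple the
  coordinates. Write \<open>\<alpha> = a\<^sub>i\<close>, \<open>\<beta> = b\<^sub>i\<close> and let \<open>\<xi>\<close>, \<open>\<upsilon>\<close> be the scalar state and input. The delay is
  removed by the predictor

  \<open>\<zeta>\<^sub>t = \<alpha>^D \<xi>\<^sub>t + \<Sum>j=1..D. \<alpha>^(j-1) \<beta> \<upsilon>\<^sub>t\<^sub>-\<^sub>j\<close>,

  the value that \<open>\<xi>\<close> would reach at time \<open>t + D\<close> without noise. It satisfies (\<open>predictor_Suc\<close>)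

  \<open>\<zeta>\<^sub>t\<^sub>+\<^sub>1 = \<alpha> \<zeta>\<^sub>t + \<beta> \<upsilon>\<^sub>t + \<alpha>^D (w0\<^sub>t c \<upsilon>\<^sub>t + wD\<^sub>t d \<upsilon>\<^sub>t\<^sub>-\<^sub>D)\<close>,

  with \<open>c = c\<^sub>i\<close> and \<open>d = cD\<^sub>i\<close>,
  so the delay survives only in one noise term. That term is handled by the functional

  \<open>Y\<^sub>t = E \<zeta>\<^sub>t\<^sup>2 + \<alpha>^(2D) \<sigma>D\<^sup>2 d\<^sup>2 \<Sum>j=1..D. E \<upsilon>\<^sub>t\<^sub>-\<^sub>j\<^sup>2\<close>,

  which stores the noise energy of inputs on their way to the plant. The noise at time \<open>t\<close> is
  independent of the closed loop up to that time, so all cross terms vanish in expectation and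
  (\<open>energy_balance\<close>)

  \<open>Y\<^sub>t\<^sub>+\<^sub>1 - Y\<^sub>t = E ((\<alpha> \<zeta>\<^sub>t + \<beta> \<upsilon>\<^sub>t)\<^sup>2 + m \<upsilon>\<^sub>t\<^sup>2 - \<zeta>\<^sub>t\<^sup>2)\<close>, where \<open>m = \<alpha>^(2D) (\<sigma>0\<^sup>2 c\<^sup>2 + \<sigma>D\<^sup>2 d\<^sup>2)\<close>.

  Completing the square in \<open>\<upsilon>\<^sub>t\<close>, the quadratic form on the right is smallest for
  \<open>\<upsilon>\<^sub>t = - \<alpha> \<beta> \<zeta>\<^sub>t / (\<beta>\<^sup>2 + m)\<close>, where it equals \<open>(\<alpha>\<^sup>2 m / (\<beta>\<^sup>2 + m) - 1) \<zeta>\<^sub>t\<^sup>2\<close>. Its sign decides everything.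

  If \<open>(\<alpha>\<^sup>2 - 1) m \<ge> \<beta>\<^sup>2\<close>, then \<open>Y\<close> never decreases, under any control. Started from the \<open>i\<close>-th unit vector
  it stays at or above \<open>\<alpha>^(2D) > 0\<close>, whereas mean-square stability and square-summable inputs would force
  it to \<open>0\<close> (\<open>stabilizable_imp_gain_bound\<close>). If \<open>(\<alpha>\<^sup>2 - 1) m < \<beta>\<^sup>2\<close>, the minimizing input is an admissible
  feedback, each step costs \<open>Y\<close> a fixed fraction of \<open>E \<zeta>\<^sub>t\<^sup>2\<close>, and as \<open>Y \<ge> 0\<close> the sum of \<open>E \<zeta>\<^sub>t\<^sup>2\<close> is
  finite; \<open>\<xi>\<close> is recovered from \<open>\<zeta>\<close> and past inputs on dividing by \<open>\<alpha>^D \<noteq> 0\<close>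
  (\<open>gain_bound_imp_stabilizable\<close>).

  Hence the system with delay \<open>D\<close> is stabilizable iff \<open>(a\<^sub>i\<^sup>2 - 1) a\<^sub>i^(2D) s\<^sub>i < b\<^sub>i\<^sup>2\<close> for all \<open>i\<close>, where
  \<open>s\<^sub>i = \<sigma>0\<^sup>2 c\<^sub>i\<^sup>2 + \<sigma>D\<^sup>2 cD\<^sub>i\<^sup>2\<close>. This holds automatically if \<open>a\<^sub>i\<^sup>2 \<le> 1\<close>; for \<open>a\<^sub>i\<^sup>2 > 1\<close> taking logarithms turns
  it into \<open>D\<close> being below the \<open>i\<close>-th quotient of the delay margin.
\<close>

section \<open>Diagonal matrices and shifted sums\<close>

lemma diag_mat_mult_nth [simp]: "(diag_mat v *v y) $ i = v $ i * y $ i"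
  by (simp add: matrix_vector_mult_def diag_mat_def if_distrib[where f="\<lambda>r. r * _"] cong: if_cong)

lemma sum_shift_window:
  fixes g :: "nat \<Rightarrow> 'a :: ab_group_add"
  shows "(\<Sum>j=1..D. g (j - 1)) = g 0 - g D + (\<Sum>j=1..D. g j)"
  by (induction D) simp_all

section \<open>Independence of the noise at distinct times\<close>

locale two_channel_noise = prob_space M for M :: "'w measure" +
  fixes w0 wD :: "nat \<Rightarrow> 'w \<Rightarrow> real" and \<sigma>0 \<sigma>D :: real
  assumes iid0: "iid_noise M w0 \<sigma>0"
    and iidD: "iid_noise M wD \<sigma>D"
    and indep_channels: "independent_sequences M w0 wD"
begin

text \<open>Both channels are merged into one family, indexed by the disjoint sum of two copies of the time
  axis, so that every independence argument below becomes disjointness of index sets.\<close>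

definition noise :: "nat + nat \<Rightarrow> 'w \<Rightarrow> real" where
  "noise = case_sum w0 wD"

lemma random_variable_channels: "random_variable borel (w0 t)" "random_variable borel (wD t)"
  using iid0 iidD by (auto simp: iid_noise_def indep_vars_def)

lemma random_variable_noise: "random_variable borel (noise j)"
  using random_variable_channels by (cases j) (auto simp: noise_def)

text \<open>The product formula for finitely many times of one channel, stated for a set comprehension so
  that the empty set of times is covered.\<close>

lemma prob_all_channel:
  assumes "indep_vars (\<lambda>_. borel :: real measure) w UNIV" "finite J"
    and "\<And>j. j \<in> J \<Longrightarrow> S j \<in> sets borel"
  shows "prob {\<omega>\<in>space M. \<forall>j\<in>J. w j \<omega> \<in> S j} = (\<Prod>j\<in>J. prob (w j -` S j \<inter> space M))"
proof (cases "J = {}")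
  case True
  then show ?thesis by (simp add: prob_space)
next
  case False
  then have "{\<omega>\<in>space M. \<forall>j\<in>J. w j \<omega> \<in> S j} = (\<Inter>j\<in>J. w j -` S j \<inter> space M)"
    by auto
  then show ?thesis
    using indep_varsD[OF assms(1) False assms(2), of S] assms(3) by simp
qed

text \<open>A finite index set splits into times of \<open>w0\<close> and times of \<open>wD\<close>. Independence of the two sequences
  as random elements of the product space separates the two parts, and independence in time
  factorizes each part.\<close>

lemma indep_vars_noise: "indep_vars (\<lambda>_. borel) noise UNIV"
  unfolding indep_vars_def2
proof (intro conjI ballI indep_setsI)
  fix j
  show "random_variable borel (noise j)" by (rule random_variable_noise)
  show "{noise j -` A \<inter> space M |A. A \<in> sets borel} \<subseteq> events"
    using random_variable_noise by (auto intro: measurable_sets)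
next
  fix A and J :: "(nat + nat) set"
  assume "J \<noteq> {}" "finite J" and "\<forall>j\<in>J. A j \<in> {noise j -` A \<inter> space M |A. A \<in> sets borel}"
  then have "\<forall>j. \<exists>S. j \<in> J \<longrightarrow> A j = noise j -` S \<inter> space M \<and> S \<in> sets borel"
    by auto
  then obtain S where S: "\<And>j. j \<in> J \<Longrightarrow> A j = noise j -` S j \<inter> space M"
    "\<And>j. j \<in> J \<Longrightarrow> S j \<in> sets borel"
    by metis
  define J0 JD where "J0 = Inl -` J" and "JD = Inr -` J"
  have fin: "finite J0" "finite JD"
    unfolding J0_def JD_def using \<open>finite J\<close> by (auto intro!: finite_vimageI)
  have J: "J = Inl ` J0 \<union> Inr ` JD"
    unfolding J0_def JD_def
    by (auto simp: image_iff) (metis old.sum.exhaust)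
  define P0 where "P0 = {f :: nat \<Rightarrow> real. \<forall>s\<in>J0. f s \<in> S (Inl s)}"
  define PD where "PD = {f :: nat \<Rightarrow> real. \<forall>s\<in>JD. f s \<in> S (Inr s)}"
  have meas: "{f :: nat \<Rightarrow> real. \<forall>s\<in>L. f s \<in> T s} \<in> sets (PiM UNIV (\<lambda>_. borel))"
    if "finite L" "\<And>s. s \<in> L \<Longrightarrow> T s \<in> sets borel" for L T
  proof -
    have "prod_emb UNIV (\<lambda>_. borel) L (\<Pi>\<^sub>E s\<in>L. T s) = {f :: nat \<Rightarrow> real. \<forall>s\<in>L. f s \<in> T s}"
      by (auto simp: prod_emb_def PiE_iff)
    then show ?thesis
      using sets_PiM_I[of L UNIV T "\<lambda>_. borel"] that by simp
  qed
  have "P0 \<in> sets (PiM UNIV (\<lambda>_. borel))" "PD \<in> sets (PiM UNIV (\<lambda>_. borel))"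
    unfolding P0_def PD_def using S(2) fin by (auto intro!: meas simp: J0_def JD_def)
  from indep_varD[OF indep_channels[unfolded independent_sequences_def] this]
  have "prob ((\<lambda>\<omega>. (\<lambda>t. w0 t \<omega>, \<lambda>t. wD t \<omega>)) -` (P0 \<times> PD) \<inter> space M) =
      prob ((\<lambda>\<omega> t. w0 t \<omega>) -` P0 \<inter> space M) * prob ((\<lambda>\<omega> t. wD t \<omega>) -` PD \<inter> space M)" .
  moreover have "(\<lambda>\<omega>. (\<lambda>t. w0 t \<omega>, \<lambda>t. wD t \<omega>)) -` (P0 \<times> PD) \<inter> space M = (\<Inter>j\<in>J. A j)"
    using \<open>J \<noteq> {}\<close> S(1) by (auto simp: P0_def PD_def J noise_def ball_Un)
  moreover have "(\<lambda>\<omega> t. w0 t \<omega>) -` P0 \<inter> space M = {\<omega>\<in>space M. \<forall>s\<in>J0. w0 s \<omega> \<in> S (Inl s)}"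
    "(\<lambda>\<omega> t. wD t \<omega>) -` PD \<inter> space M = {\<omega>\<in>space M. \<forall>s\<in>JD. wD s \<omega> \<in> S (Inr s)}"
    by (auto simp: P0_def PD_def)
  moreover have "prob {\<omega>\<in>space M. \<forall>s\<in>J0. w0 s \<omega> \<in> S (Inl s)} = (\<Prod>s\<in>J0. prob (A (Inl s)))"
    using iid0 fin S by (subst prob_all_channel) (auto simp: iid_noise_def J noise_def)
  moreover have "prob {\<omega>\<in>space M. \<forall>s\<in>JD. wD s \<omega> \<in> S (Inr s)} = (\<Prod>s\<in>JD. prob (A (Inr s)))"
    using iidD fin S by (subst prob_all_channel) (auto simp: iid_noise_def J noise_def)
  moreover have "(\<Prod>j\<in>J. prob (A j)) = (\<Prod>s\<in>J0. prob (A (Inl s))) * (\<Prod>s\<in>JD. prob (A (Inr s)))"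
    unfolding J using fin by (subst prod.union_disjoint) (auto simp: prod.reindex)
  ultimately show "prob (\<Inter>j\<in>J. A j) = (\<Prod>j\<in>J. prob (A j))"
    by simp
qed

definition noise_sigma :: "(nat + nat) set \<Rightarrow> 'w measure" where
  "noise_sigma J = sigma (space M) (\<Union>j\<in>J. {noise j -` S \<inter> space M | S. S \<in> sets borel})"

lemma space_noise_sigma [simp]: "space (noise_sigma J) = space M"
  by (simp add: noise_sigma_def space_measure_of_conv)

lemma sets_noise_sigma:
  "sets (noise_sigma J) = sigma_sets (space M) (\<Union>j\<in>J. {noise j -` S \<inter> space M | S. S \<in> sets borel})"
  unfolding noise_sigma_def by (rule sets_measure_of) auto

lemma noise_sigma_mono: "J \<subseteq> K \<Longrightarrow> borel_measurable (noise_sigma J) \<subseteq> borel_measurable (noise_sigma K)"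
  unfolding noise_sigma_def by (rule measurable_mono1) auto

lemma sets_noise_sigma_subset: "sets (noise_sigma J) \<subseteq> events"
  unfolding sets_noise_sigma using random_variable_noise
  by (auto intro!: sets.sigma_sets_subset measurable_sets)

lemma random_variable_noise_sigma:
  "f \<in> borel_measurable (noise_sigma J) \<Longrightarrow> random_variable borel f"
  using measurable_mono[OF order.refl refl sets_noise_sigma_subset, of J borel] by auto

lemma measurable_noise: "j \<in> J \<Longrightarrow> noise j \<in> borel_measurable (noise_sigma J)"
  by (rule measurableI) (auto simp: sets_noise_sigma)

text \<open>Preimages of Borel sets in one coordinate form an intersection-stable generator, so
  independence passes from the coordinates to the \<open>\<sigma>\<close>-algebras generated by disjoint blocks of
  them, and thence to functions measurable with respect to these.\<close>

lemma indep_var_noise_sigma: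
  fixes X Y :: "'w \<Rightarrow> real"
  assumes "J \<inter> K = {}"
    and X: "X \<in> borel_measurable (noise_sigma J)" and Y: "Y \<in> borel_measurable (noise_sigma K)"
  shows "indep_var borel X borel Y"
proof -
  let ?E = "\<lambda>j. {noise j -` S \<inter> space M | S. S \<in> sets borel}"
  let ?I = "case_bool J K"
  have "indep_sets (\<lambda>b. sigma_sets (space M) (\<Union>j\<in>?I b. ?E j)) UNIV"
  proof (rule indep_sets_collect_sigma)
    show "indep_sets ?E (\<Union>b\<in>UNIV. ?I b)"
      using indep_vars_noise by (auto simp: indep_vars_def2 intro: indep_sets_mono_index)
    show "Int_stable (?E j)" for j
    proof (rule Int_stableI)
      fix A B assume "A \<in> ?E j" "B \<in> ?E j"
      then obtain S T where "A = noise j -` S \<inter> space M" "S \<in> sets borel"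
        "B = noise j -` T \<inter> space M" "T \<in> sets borel" by auto
      then show "A \<inter> B \<in> ?E j"
        by (auto intro!: exI[of _ "S \<inter> T"])
    qed
    show "disjoint_family_on ?I UNIV"
      using \<open>J \<inter> K = {}\<close> by (auto simp: disjoint_family_on_def split: bool.splits)
  qed
  moreover have "sigma_sets (space M) {X -` A \<inter> space M | A. A \<in> sets borel} \<subseteq> sets (noise_sigma J)"
    using measurable_sets[OF X]
    by (intro sets.sigma_sets_subset[of _ "noise_sigma J", simplified]) auto
  moreover have "sigma_sets (space M) {Y -` A \<inter> space M | A. A \<in> sets borel} \<subseteq> sets (noise_sigma K)"
    using measurable_sets[OF Y]
    by (intro sets.sigma_sets_subset[of _ "noise_sigma K", simplified]) auto
  ultimately have "indep_set (sigma_sets (space M) {X -` A \<inter> space M | A. A \<in> sets borel})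
      (sigma_sets (space M) {Y -` A \<inter> space M | A. A \<in> sets borel})"
    unfolding indep_set_def sets_noise_sigma
    by (elim indep_sets_mono_sets) (auto split: bool.splits)
  then show ?thesis
    using X Y by (simp add: indep_var_eq random_variable_noise_sigma)
qed

lemma
  fixes X Y :: "'w \<Rightarrow> real"
  assumes "J \<inter> K = {}"
    and "X \<in> borel_measurable (noise_sigma J)" "Y \<in> borel_measurable (noise_sigma K)"
    and "integrable M X" "integrable M Y"
  shows integrable_mult_noise_sigma: "integrable M (\<lambda>\<omega>. X \<omega> * Y \<omega>)"
    and expectation_mult_noise_sigma:
      "expectation (\<lambda>\<omega>. X \<omega> * Y \<omega>) = expectation X * expectation Y"
  using indep_var_integrable[OF indep_var_noise_sigma[OF assms(1-3)] assms(4,5)]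
    indep_var_lebesgue_integral[OF indep_var_noise_sigma[OF assms(1-3)] assms(4,5)] by auto

section \<open>Square-integrable functions of the past\<close>

text \<open>The closed loop at time \<open>t\<close> depends on the noise strictly before \<open>t\<close> only. This is one step less
  than the filtration in the definition of admissibility provides, and it is what makes the noise
  at time \<open>t\<close> independent of state and input at time \<open>t\<close>.\<close>

definition past :: "nat \<Rightarrow> 'w measure" where
  "past t = noise_sigma ({..<t} <+> {..<t})"

lemma past_Suc: "past (Suc t) = noise_filtration M w0 wD t"
  unfolding past_def noise_sigma_def noise_filtration_def
  by (rule arg_cong[where f="sigma (space M)"]) (simp add: noise_def Plus_def lessThan_Suc_atMost UN_Un_distrib)

lemma past_mono: "s \<le> t \<Longrightarrow> borel_measurable (past s) \<subseteq> borel_measurable (past t)"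
  unfolding past_def by (rule noise_sigma_mono) auto

definition L2_past :: "nat \<Rightarrow> ('w \<Rightarrow> real) \<Rightarrow> bool" where
  "L2_past t f \<longleftrightarrow> f \<in> borel_measurable (past t) \<and> integrable M (\<lambda>\<omega>. (f \<omega>)\<^sup>2)"

lemma L2_past_random_variable: "L2_past t f \<Longrightarrow> random_variable borel f"
  by (auto simp: L2_past_def past_def intro: random_variable_noise_sigma)

lemma L2_past_integrable_square: "L2_past t f \<Longrightarrow> integrable M (\<lambda>\<omega>. (f \<omega>)\<^sup>2)"
  by (simp add: L2_past_def)

lemma L2_past_mono: "L2_past s f \<Longrightarrow> s \<le> t \<Longrightarrow> L2_past t f"
  using past_mono by (auto simp: L2_past_def)

lemma L2_past_eqI:
  assumes "L2_past t g" and eq: "\<And>\<omega>. \<omega> \<in> space M \<Longrightarrow> f \<omega> = g \<omega>"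
  shows "L2_past t f"
proof -
  have "f \<in> borel_measurable (past t) \<longleftrightarrow> g \<in> borel_measurable (past t)"
    by (rule measurable_cong) (simp add: past_def eq)
  moreover have "integrable M (\<lambda>\<omega>. (f \<omega>)\<^sup>2) \<longleftrightarrow> integrable M (\<lambda>\<omega>. (g \<omega>)\<^sup>2)"
    by (rule Bochner_Integration.integrable_cong) (simp_all add: eq)
  ultimately show ?thesis using assms(1) by (simp add: L2_past_def)
qed

lemma L2_past_integrable_mult:
  assumes "L2_past t f" "L2_past t g"
  shows "integrable M (\<lambda>\<omega>. f \<omega> * g \<omega>)"
proof (rule Bochner_Integration.integrable_bound)
  show "integrable M (\<lambda>\<omega>. (f \<omega>)\<^sup>2 + (g \<omega>)\<^sup>2)"
    using assms by (simp add: L2_past_integrable_square)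
  show "(\<lambda>\<omega>. f \<omega> * g \<omega>) \<in> borel_measurable M"
    using assms by (intro borel_measurable_times L2_past_random_variable)
  have "\<bar>r * s\<bar> \<le> r\<^sup>2 + s\<^sup>2" for r s :: real
  proof -
    have "2 * \<bar>r * s\<bar> \<le> r\<^sup>2 + s\<^sup>2"
      using sum_squares_bound[of "\<bar>r\<bar>" "\<bar>s\<bar>"] by (simp add: abs_mult)
    then show ?thesis by linarith
  qed
  then show "AE \<omega> in M. norm (f \<omega> * g \<omega>) \<le> norm ((f \<omega>)\<^sup>2 + (g \<omega>)\<^sup>2)"
    by simp
qed

lemma L2_past_const: "L2_past t (\<lambda>_. r)"
  by (simp add: L2_past_def)

lemma L2_past_scale: "L2_past t f \<Longrightarrow> L2_past t (\<lambda>\<omega>. r * f \<omega>)"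
  by (auto simp: L2_past_def power_mult_distrib)

lemma L2_past_add:
  assumes "L2_past t f" "L2_past t g"
  shows "L2_past t (\<lambda>\<omega>. f \<omega> + g \<omega>)"
  using assms L2_past_integrable_mult[OF assms]
  by (auto simp: L2_past_def power2_sum mult.assoc)

lemma L2_past_sum: "(\<And>j. j \<in> J \<Longrightarrow> L2_past t (f j)) \<Longrightarrow> L2_past t (\<lambda>\<omega>. \<Sum>j\<in>J. f j \<omega>)"
  by (induction J rule: infinite_finite_induct) (auto intro: L2_past_add L2_past_const)

lemma noise_moments:
  shows "integrable M (w0 t)" "integrable M (wD t)"
    and "integrable M (\<lambda>\<omega>. (w0 t \<omega>)\<^sup>2)" "integrable M (\<lambda>\<omega>. (wD t \<omega>)\<^sup>2)"
    and "expectation (w0 t) = 0" "expectation (wD t) = 0"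
    and "expectation (\<lambda>\<omega>. (w0 t \<omega>)\<^sup>2) = \<sigma>0\<^sup>2" "expectation (\<lambda>\<omega>. (wD t \<omega>)\<^sup>2) = \<sigma>D\<^sup>2"
  using iid0 iidD by (simp_all add: iid_noise_def power2_eq_square)

lemma channels_uncorrelated:
  "integrable M (\<lambda>\<omega>. w0 t \<omega> * wD t \<omega>)" "expectation (\<lambda>\<omega>. w0 t \<omega> * wD t \<omega>) = 0"
proof -
  have "w0 t \<in> borel_measurable (noise_sigma {Inl t})" "wD t \<in> borel_measurable (noise_sigma {Inr t})"
    using measurable_noise[of "Inl t" "{Inl t}"] measurable_noise[of "Inr t" "{Inr t}"]
    by (simp_all add: noise_def)
  moreover have "{Inl t :: nat + nat} \<inter> {Inr t} = {}" by simp
  ultimately show "integrable M (\<lambda>\<omega>. w0 t \<omega> * wD t \<omega>)" "expectation (\<lambda>\<omega>. w0 t \<omega> * wD t \<omega>) = 0"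
    using integrable_mult_noise_sigma[of "{Inl t}" "{Inr t}" "w0 t" "wD t"]
      expectation_mult_noise_sigma[of "{Inl t}" "{Inr t}" "w0 t" "wD t"] noise_moments
    by auto
qed

lemma
  fixes X Y :: "'w \<Rightarrow> real"
  assumes "X \<in> borel_measurable (noise_sigma {Inl t, Inr t})" "integrable M X"
    and "Y \<in> borel_measurable (past t)" "integrable M Y"
  shows integrable_present_mult_past: "integrable M (\<lambda>\<omega>. X \<omega> * Y \<omega>)"
    and expectation_present_mult_past:
      "expectation (\<lambda>\<omega>. X \<omega> * Y \<omega>) = expectation X * expectation Y"
  using assms integrable_mult_noise_sigma[of "{Inl t, Inr t}" "{..<t} <+> {..<t}" X Y]
    expectation_mult_noise_sigma[of "{Inl t, Inr t}" "{..<t} <+> {..<t}" X Y]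
  unfolding past_def by auto

text \<open>Expanding the square gives three square terms and three cross terms. Each is a product of a
  function of the present noise and a function of the past, hence its expectation factorizes; the
  noise factors of the cross terms, \<open>w0\<close>, \<open>wD\<close> and \<open>w0 wD\<close>, have mean zero.\<close>

lemma
  assumes p: "L2_past t p" and q: "L2_past t q" and r: "L2_past t r"
  shows L2_past_noise_step: "L2_past (Suc t) (\<lambda>\<omega>. p \<omega> + w0 t \<omega> * q \<omega> + wD t \<omega> * r \<omega>)"
    and expectation_noise_step:
      "expectation (\<lambda>\<omega>. (p \<omega> + w0 t \<omega> * q \<omega> + wD t \<omega> * r \<omega>)\<^sup>2) =
        expectation (\<lambda>\<omega>. (p \<omega>)\<^sup>2) + \<sigma>0\<^sup>2 * expectation (\<lambda>\<omega>. (q \<omega>)\<^sup>2)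
        + \<sigma>D\<^sup>2 * expectation (\<lambda>\<omega>. (r \<omega>)\<^sup>2)"
proof -
  let ?N = "noise_sigma {Inl t, Inr t}"
  have w: "w0 t \<in> borel_measurable ?N" "wD t \<in> borel_measurable ?N"
    using measurable_noise[of "Inl t" "{Inl t, Inr t}"] measurable_noise[of "Inr t" "{Inl t, Inr t}"]
    by (simp_all add: noise_def)
  have meas: "p \<in> borel_measurable (past t)" "q \<in> borel_measurable (past t)"
    "r \<in> borel_measurable (past t)"
    using p q r by (simp_all add: L2_past_def)
  note sq = L2_past_integrable_square[OF p] L2_past_integrable_square[OF q]
    L2_past_integrable_square[OF r]
  note mult = L2_past_integrable_mult[OF p q] L2_past_integrable_mult[OF p r]
    L2_past_integrable_mult[OF q r]
  have terms: "integrable M (\<lambda>\<omega>. (w0 t \<omega>)\<^sup>2 * (q \<omega>)\<^sup>2)"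
    "expectation (\<lambda>\<omega>. (w0 t \<omega>)\<^sup>2 * (q \<omega>)\<^sup>2) = \<sigma>0\<^sup>2 * expectation (\<lambda>\<omega>. (q \<omega>)\<^sup>2)"
    "integrable M (\<lambda>\<omega>. (wD t \<omega>)\<^sup>2 * (r \<omega>)\<^sup>2)"
    "expectation (\<lambda>\<omega>. (wD t \<omega>)\<^sup>2 * (r \<omega>)\<^sup>2) = \<sigma>D\<^sup>2 * expectation (\<lambda>\<omega>. (r \<omega>)\<^sup>2)"
    "integrable M (\<lambda>\<omega>. w0 t \<omega> * (p \<omega> * q \<omega>))" "expectation (\<lambda>\<omega>. w0 t \<omega> * (p \<omega> * q \<omega>)) = 0"
    "integrable M (\<lambda>\<omega>. wD t \<omega> * (p \<omega> * r \<omega>))" "expectation (\<lambda>\<omega>. wD t \<omega> * (p \<omega> * r \<omega>)) = 0"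
    "integrable M (\<lambda>\<omega>. (w0 t \<omega> * wD t \<omega>) * (q \<omega> * r \<omega>))"
    "expectation (\<lambda>\<omega>. (w0 t \<omega> * wD t \<omega>) * (q \<omega> * r \<omega>)) = 0"
    using w meas sq mult noise_moments channels_uncorrelated
    by (simp_all add: integrable_present_mult_past[where t=t]
        expectation_present_mult_past[where t=t])
  have expand: "(\<lambda>\<omega>. (p \<omega> + w0 t \<omega> * q \<omega> + wD t \<omega> * r \<omega>)\<^sup>2) = (\<lambda>\<omega>.
      (p \<omega>)\<^sup>2 + (w0 t \<omega>)\<^sup>2 * (q \<omega>)\<^sup>2 + (wD t \<omega>)\<^sup>2 * (r \<omega>)\<^sup>2 + 2 * (w0 t \<omega> * (p \<omega> * q \<omega>))
      + 2 * (wD t \<omega> * (p \<omega> * r \<omega>)) + 2 * ((w0 t \<omega> * wD t \<omega>) * (q \<omega> * r \<omega>)))"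
    by (intro ext) algebra
  have "w0 t \<in> borel_measurable (past (Suc t))" "wD t \<in> borel_measurable (past (Suc t))"
    using measurable_noise[of "Inl t" "{..<Suc t} <+> {..<Suc t}"]
      measurable_noise[of "Inr t" "{..<Suc t} <+> {..<Suc t}"]
    by (auto simp: noise_def past_def)
  then show "L2_past (Suc t) (\<lambda>\<omega>. p \<omega> + w0 t \<omega> * q \<omega> + wD t \<omega> * r \<omega>)"
    using past_mono[of t "Suc t"] meas sq(1) terms unfolding L2_past_def expand
    by (auto intro!: borel_measurable_add borel_measurable_times)
  show "expectation (\<lambda>\<omega>. (p \<omega> + w0 t \<omega> * q \<omega> + wD t \<omega> * r \<omega>)\<^sup>2) =
      expectation (\<lambda>\<omega>. (p \<omega>)\<^sup>2) + \<sigma>0\<^sup>2 * expectation (\<lambda>\<omega>. (q \<omega>)\<^sup>2)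
      + \<sigma>D\<^sup>2 * expectation (\<lambda>\<omega>. (r \<omega>)\<^sup>2)"
    unfolding expand using sq terms by simp
qed

section \<open>The closed loop in coordinates\<close>

lemma closed_loop_state_nth:
  fixes a c b cD :: "real ^ 'n"
  assumes "closed_loop M w0 wD (diag_mat a) (diag_mat c) (diag_mat b) (diag_mat cD) D K x0 \<phi> x u"
    and "\<omega> \<in> space M"
  shows "x (Suc t) \<omega> $ i = a $ i * x t \<omega> $ i + b $ i * u (int t - int D) \<omega> $ i
    + w0 t \<omega> * (c $ i * u (int t) \<omega> $ i) + wD t \<omega> * (cD $ i * u (int t - int D) \<omega> $ i)"
  using assms
  by (simp add: closed_loop_def state_equation_def matrix_vector_mult_add_rdistrib
      scaleR_matrix_vector_assoc[symmetric])

lemma closed_loop_control_nth: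
  assumes "closed_loop M w0 wD A C0 B C D K x0 \<phi> x u" and "\<omega> \<in> space M"
  shows "u (int t) \<omega> $ i = (\<Sum>k\<in>UNIV. K 0 $ i $ k * x t \<omega> $ k)
    + (\<Sum>\<tau>=1..D. \<Sum>k\<in>UNIV. K \<tau> $ i $ k * u (int t - int \<tau>) \<omega> $ k)"
  using assms by (simp add: closed_loop_def feedback_law_def matrix_vector_mult_def)

text \<open>Induction on time. The gain matrices may be full, so the claim for one input coordinate needs
  that for all coordinates of the state and of the earlier inputs. Initial inputs are constants and
  are assigned to time \<open>nat s = 0\<close>.\<close>

lemma closed_loop_L2_past:
  fixes a c b cD :: "real ^ 'n"
  assumes "closed_loop M w0 wD (diag_mat a) (diag_mat c) (diag_mat b) (diag_mat cD) D K x0 \<phi> x u"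
  shows "L2_past t (\<lambda>\<omega>. x t \<omega> $ i)"
    and "- int D \<le> s \<Longrightarrow> L2_past (nat s) (\<lambda>\<omega>. u s \<omega> $ i)"
proof -
  have init: "x 0 \<omega> = x0" "s \<in> {- int D..-1} \<Longrightarrow> u s \<omega> = \<phi> s" if "\<omega> \<in> space M" for \<omega> s
    using assms that by (auto simp: closed_loop_def initial_data_def)
  note state = closed_loop_state_nth[OF assms]
  note control = closed_loop_control_nth[OF assms]
  have "(\<forall>i. L2_past t (\<lambda>\<omega>. x t \<omega> $ i)) \<and> (\<forall>i. L2_past t (\<lambda>\<omega>. u (int t) \<omega> $ i))" for t
  proof (induction t rule: less_induct)
    case (less t)
    have past_input: "L2_past r (\<lambda>\<omega>. u s \<omega> $ i)"
      if "- int D \<le> s" "s < int t" "nat s \<le> r" for s r i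
    proof (cases "s < 0")
      case True
      then show ?thesis
        using that by (intro L2_past_eqI[OF L2_past_const[of r "\<phi> s $ i"]]) (simp add: init)
    next
      case False
      then show ?thesis
        using less[of "nat s"] that L2_past_mono[of "nat s" _ r] by auto
    qed
    have x: "L2_past t (\<lambda>\<omega>. x t \<omega> $ i)" for i
    proof (cases t)
      case 0
      then show ?thesis
        by (intro L2_past_eqI[OF L2_past_const[of t "x0 $ i"]]) (simp add: init)
    next
      case (Suc r)
      then have *: "L2_past r (\<lambda>\<omega>. x r \<omega> $ i)" "L2_past r (\<lambda>\<omega>. u (int r) \<omega> $ i)"
        "L2_past r (\<lambda>\<omega>. u (int r - int D) \<omega> $ i)"
        using less[of r] past_input[of "int r - int D" r] by auto
      show ?thesis
        unfolding Suc
        by (rule L2_past_eqI[OF _ state[where t=r and i=i]],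
            intro L2_past_noise_step L2_past_add L2_past_scale *, assumption)
    qed
    have "L2_past t (\<lambda>\<omega>. u (int t) \<omega> $ i)" for i
      by (rule L2_past_eqI[OF _ control[where t=t and i=i]])
        (auto intro!: L2_past_add L2_past_sum L2_past_scale x past_input)
    with x show ?case by simp
  qed
  note L2 = this
  show "L2_past t (\<lambda>\<omega>. x t \<omega> $ i)" using L2 by simp
  show "L2_past (nat s) (\<lambda>\<omega>. u s \<omega> $ i)" if "- int D \<le> s"
  proof (cases "s < 0")
    case True
    then show ?thesis
      using that by (intro L2_past_eqI[OF L2_past_const[of _ "\<phi> s $ i"]]) (simp add: init)
  next
    case False
    then show ?thesis using L2[of "nat s"] by simp
  qed
qed

section \<open>Predictor and energy of a scalar system with input delay\<close>

text \<open>A single coordinate of the closed loop, without the feedback law: the input is an arbitrary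
  square-integrable function of the past.\<close>

definition scalar_channel ::
    "real \<Rightarrow> real \<Rightarrow> real \<Rightarrow> real \<Rightarrow> nat \<Rightarrow> (nat \<Rightarrow> 'w \<Rightarrow> real) \<Rightarrow> (int \<Rightarrow> 'w \<Rightarrow> real) \<Rightarrow> bool" where
  "scalar_channel \<alpha> \<gamma> \<beta> \<delta> D \<xi> \<upsilon> \<longleftrightarrow>
     (\<forall>t. L2_past t (\<xi> t)) \<and> (\<forall>s\<ge>- int D. L2_past (nat s) (\<upsilon> s)) \<and>
     (\<forall>t. \<forall>\<omega>\<in>space M. \<xi> (Suc t) \<omega> = \<alpha> * \<xi> t \<omega> + \<beta> * \<upsilon> (int t - int D) \<omega>
        + w0 t \<omega> * (\<gamma> * \<upsilon> (int t) \<omega>) + wD t \<omega> * (\<delta> * \<upsilon> (int t - int D) \<omega>))"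

text \<open>The state that the noise-free system, driven by the inputs already issued, reaches after \<open>D\<close>
  steps.\<close>

definition predictor ::
    "real \<Rightarrow> real \<Rightarrow> nat \<Rightarrow> (nat \<Rightarrow> 'w \<Rightarrow> real) \<Rightarrow> (int \<Rightarrow> 'w \<Rightarrow> real) \<Rightarrow> nat \<Rightarrow> 'w \<Rightarrow> real" where
  "predictor \<alpha> \<beta> D \<xi> \<upsilon> t \<omega> =
     \<alpha> ^ D * \<xi> t \<omega> + (\<Sum>j=1..D. \<alpha> ^ (j - 1) * \<beta> * \<upsilon> (int t - int j) \<omega>)"

text \<open>The second summand makes up for the lag of the noise term \<open>wD\<^sub>t \<delta> \<upsilon>\<^sub>t\<^sub>-\<^sub>D\<close>: an input is charged with
  the noise it will cause when it is issued instead of when it arrives.\<close>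

definition energy ::
    "real \<Rightarrow> real \<Rightarrow> real \<Rightarrow> nat \<Rightarrow> (nat \<Rightarrow> 'w \<Rightarrow> real) \<Rightarrow> (int \<Rightarrow> 'w \<Rightarrow> real) \<Rightarrow> nat \<Rightarrow> real" where
  "energy \<alpha> \<beta> \<delta> D \<xi> \<upsilon> t = expectation (\<lambda>\<omega>. (predictor \<alpha> \<beta> D \<xi> \<upsilon> t \<omega>)\<^sup>2)
     + (\<alpha>\<^sup>2) ^ D * \<sigma>D\<^sup>2 * \<delta>\<^sup>2 * (\<Sum>j=1..D. expectation (\<lambda>\<omega>. (\<upsilon> (int t - int j) \<omega>)\<^sup>2))"

lemma scalar_channel_input_L2:
  "scalar_channel \<alpha> \<gamma> \<beta> \<delta> D \<xi> \<upsilon> \<Longrightarrow> j \<le> D \<Longrightarrow> L2_past t (\<upsilon> (int t - int j))"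
  by (rule L2_past_mono[of "nat (int t - int j)"]) (auto simp: scalar_channel_def)

lemma predictor_L2:
  assumes "scalar_channel \<alpha> \<gamma> \<beta> \<delta> D \<xi> \<upsilon>"
  shows "L2_past t (predictor \<alpha> \<beta> D \<xi> \<upsilon> t)"
  unfolding predictor_def[abs_def]
  by (intro L2_past_add L2_past_sum L2_past_scale scalar_channel_input_L2[OF assms])
    (use assms in \<open>auto simp: scalar_channel_def\<close>)

text \<open>Shifting the window of past inputs by one step adds the term \<open>\<beta> \<upsilon>\<^sub>t\<close> and removes
  \<open>\<alpha>^D \<beta> \<upsilon>\<^sub>t\<^sub>-\<^sub>D\<close>, and the latter cancels against the delayed drift of \<open>\<xi>\<close>.\<close>

lemma predictor_Suc:
  assumes "scalar_channel \<alpha> \<gamma> \<beta> \<delta> D \<xi> \<upsilon>" "\<omega> \<in> space M"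
  shows "predictor \<alpha> \<beta> D \<xi> \<upsilon> (Suc t) \<omega> =
    (\<alpha> * predictor \<alpha> \<beta> D \<xi> \<upsilon> t \<omega> + \<beta> * \<upsilon> (int t) \<omega>)
    + w0 t \<omega> * (\<alpha> ^ D * \<gamma> * \<upsilon> (int t) \<omega>) + wD t \<omega> * (\<alpha> ^ D * \<delta> * \<upsilon> (int t - int D) \<omega>)"
proof -
  define g where "g j = \<alpha> ^ j * \<beta> * \<upsilon> (int t - int j) \<omega>" for j
  have "(\<Sum>j=1..D. \<alpha> ^ (j - 1) * \<beta> * \<upsilon> (int (Suc t) - int j) \<omega>) = (\<Sum>j=1..D. g (j - 1))"
    by (rule sum.cong) (auto simp: g_def of_nat_diff algebra_simps)
  also have "\<dots> = g 0 - g D + (\<Sum>j=1..D. g j)"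
    by (rule sum_shift_window)
  also have "(\<Sum>j=1..D. g j) = \<alpha> * (\<Sum>j=1..D. \<alpha> ^ (j - 1) * \<beta> * \<upsilon> (int t - int j) \<omega>)"
    unfolding sum_distrib_left g_def
    by (rule sum.cong) (auto simp: power_eq_if)
  finally show ?thesis
    using assms by (simp add: predictor_def scalar_channel_def g_def algebra_simps)
qed

text \<open>The noise step adds \<open>\<alpha>^(2D) \<sigma>D\<^sup>2 \<delta>\<^sup>2 E \<upsilon>\<^sub>t\<^sub>-\<^sub>D\<^sup>2\<close> to the second moment of the predictor, while the shift of
  the window in the stored energy trades exactly this amount for the same multiple of \<open>E \<upsilon>\<^sub>t\<^sup>2\<close>. No
  delayed quantity remains, and the increment is a quadratic form in \<open>(\<zeta>\<^sub>t, \<upsilon>\<^sub>t)\<close>.\<close>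

lemma energy_balance:
  assumes "scalar_channel \<alpha> \<gamma> \<beta> \<delta> D \<xi> \<upsilon>"
  shows "energy \<alpha> \<beta> \<delta> D \<xi> \<upsilon> (Suc t) - energy \<alpha> \<beta> \<delta> D \<xi> \<upsilon> t =
    expectation (\<lambda>\<omega>. (\<alpha> * predictor \<alpha> \<beta> D \<xi> \<upsilon> t \<omega> + \<beta> * \<upsilon> (int t) \<omega>)\<^sup>2
      + (\<alpha>\<^sup>2) ^ D * (\<sigma>0\<^sup>2 * \<gamma>\<^sup>2 + \<sigma>D\<^sup>2 * \<delta>\<^sup>2) * (\<upsilon> (int t) \<omega>)\<^sup>2
      - (predictor \<alpha> \<beta> D \<xi> \<upsilon> t \<omega>)\<^sup>2)"
    (is "_ = expectation (\<lambda>\<omega>. (?p \<omega>)\<^sup>2 + _ * (\<upsilon> (int t) \<omega>)\<^sup>2 - (?z \<omega>)\<^sup>2)")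
proof -
  let ?E = "\<lambda>s. expectation (\<lambda>\<omega>. (\<upsilon> s \<omega>)\<^sup>2)"
  have v: "L2_past t (\<upsilon> (int t))" "L2_past t (\<upsilon> (int t - int D))"
    using scalar_channel_input_L2[OF assms, of 0] scalar_channel_input_L2[OF assms, of D] by auto
  have z: "L2_past t ?z" by (rule predictor_L2[OF assms])
  have p: "L2_past t ?p" by (intro L2_past_add L2_past_scale z v)
  have "expectation (\<lambda>\<omega>. (predictor \<alpha> \<beta> D \<xi> \<upsilon> (Suc t) \<omega>)\<^sup>2) =
      expectation (\<lambda>\<omega>. (?p \<omega> + w0 t \<omega> * (\<alpha> ^ D * \<gamma> * \<upsilon> (int t) \<omega>)
        + wD t \<omega> * (\<alpha> ^ D * \<delta> * \<upsilon> (int t - int D) \<omega>))\<^sup>2)"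
    by (rule Bochner_Integration.integral_cong) (simp_all add: predictor_Suc[OF assms])
  also have "\<dots> = expectation (\<lambda>\<omega>. (?p \<omega>)\<^sup>2)
      + \<sigma>0\<^sup>2 * expectation (\<lambda>\<omega>. (\<alpha> ^ D * \<gamma> * \<upsilon> (int t) \<omega>)\<^sup>2)
      + \<sigma>D\<^sup>2 * expectation (\<lambda>\<omega>. (\<alpha> ^ D * \<delta> * \<upsilon> (int t - int D) \<omega>)\<^sup>2)"
    by (intro expectation_noise_step L2_past_scale p v)
  also have "\<dots> = expectation (\<lambda>\<omega>. (?p \<omega>)\<^sup>2) + (\<alpha>\<^sup>2) ^ D * \<sigma>0\<^sup>2 * \<gamma>\<^sup>2 * ?E (int t)
      + (\<alpha>\<^sup>2) ^ D * \<sigma>D\<^sup>2 * \<delta>\<^sup>2 * ?E (int t - int D)"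
    by (simp add: power_mult_distrib power_mult[symmetric] mult.commute[of 2] mult_ac)
  finally have step: "expectation (\<lambda>\<omega>. (predictor \<alpha> \<beta> D \<xi> \<upsilon> (Suc t) \<omega>)\<^sup>2) = \<dots>" .
  have "(\<Sum>j=1..D. ?E (int (Suc t) - int j)) = (\<Sum>j=1..D. (\<lambda>j. ?E (int t - int j)) (j - 1))"
    by (rule sum.cong) (auto simp: of_nat_diff algebra_simps)
  also have "\<dots> = ?E (int t) - ?E (int t - int D) + (\<Sum>j=1..D. ?E (int t - int j))"
    by (subst sum_shift_window) simp
  finally have window: "(\<Sum>j=1..D. ?E (int (Suc t) - int j)) = \<dots>" .
  have "expectation (\<lambda>\<omega>. (?p \<omega>)\<^sup>2
        + (\<alpha>\<^sup>2) ^ D * (\<sigma>0\<^sup>2 * \<gamma>\<^sup>2 + \<sigma>D\<^sup>2 * \<delta>\<^sup>2) * (\<upsilon> (int t) \<omega>)\<^sup>2 - (?z \<omega>)\<^sup>2) =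
      expectation (\<lambda>\<omega>. (?p \<omega>)\<^sup>2) + (\<alpha>\<^sup>2) ^ D * (\<sigma>0\<^sup>2 * \<gamma>\<^sup>2 + \<sigma>D\<^sup>2 * \<delta>\<^sup>2) * ?E (int t)
      - expectation (\<lambda>\<omega>. (?z \<omega>)\<^sup>2)"
    using L2_past_integrable_square[OF p] L2_past_integrable_square[OF z]
      L2_past_integrable_square[OF v(1)] by simp
  then show ?thesis
    unfolding energy_def step window by (simp add: algebra_simps)
qed

lemma closed_loop_scalar_channel:
  fixes a c b cD :: "real ^ 'n"
  assumes "closed_loop M w0 wD (diag_mat a) (diag_mat c) (diag_mat b) (diag_mat cD) D K x0 \<phi> x u"
  shows "scalar_channel (a $ i) (c $ i) (b $ i) (cD $ i) D (\<lambda>t \<omega>. x t \<omega> $ i) (\<lambda>s \<omega>. u s \<omega> $ i)"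
  using closed_loop_L2_past[OF assms] closed_loop_state_nth[OF assms]
  by (auto simp: scalar_channel_def)

section \<open>Mean-square convergence to zero\<close>

definition ms_null :: "(nat \<Rightarrow> 'w \<Rightarrow> real) \<Rightarrow> bool" where
  "ms_null f \<longleftrightarrow> (\<lambda>t. expectation (\<lambda>\<omega>. (f t \<omega>)\<^sup>2)) \<longlonglongrightarrow> 0"

lemma ms_null_add:
  assumes L2: "\<And>t. L2_past t (f t)" "\<And>t. L2_past t (g t)" and null: "ms_null f" "ms_null g"
  shows "ms_null (\<lambda>t \<omega>. f t \<omega> + g t \<omega>)"
  unfolding ms_null_def
proof (rule tendsto_sandwich[OF _ _ tendsto_const])
  let ?h = "\<lambda>t. 2 * expectation (\<lambda>\<omega>. (f t \<omega>)\<^sup>2) + 2 * expectation (\<lambda>\<omega>. (g t \<omega>)\<^sup>2)"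
  have "?h \<longlonglongrightarrow> 2 * 0 + 2 * 0"
    using null unfolding ms_null_def by (intro tendsto_intros)
  then show "?h \<longlonglongrightarrow> 0" by simp
  have "expectation (\<lambda>\<omega>. (f t \<omega> + g t \<omega>)\<^sup>2) \<le> ?h t" for t
  proof -
    have "expectation (\<lambda>\<omega>. (f t \<omega> + g t \<omega>)\<^sup>2)
        \<le> expectation (\<lambda>\<omega>. 2 * (f t \<omega>)\<^sup>2 + 2 * (g t \<omega>)\<^sup>2)"
    proof (rule integral_mono)
      show "integrable M (\<lambda>\<omega>. (f t \<omega> + g t \<omega>)\<^sup>2)"
        by (rule L2_past_integrable_square[OF L2_past_add[OF L2]])
      show "integrable M (\<lambda>\<omega>. 2 * (f t \<omega>)\<^sup>2 + 2 * (g t \<omega>)\<^sup>2)"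
        using L2_past_integrable_square[OF L2(1)] L2_past_integrable_square[OF L2(2)] by simp
      show "(f t \<omega> + g t \<omega>)\<^sup>2 \<le> 2 * (f t \<omega>)\<^sup>2 + 2 * (g t \<omega>)\<^sup>2" for \<omega>
        using sum_squares_bound[of "f t \<omega>" "g t \<omega>"] by (simp add: power2_sum)
    qed
    also have "\<dots> = ?h t"
      using L2_past_integrable_square[OF L2(1)] L2_past_integrable_square[OF L2(2)] by simp
    finally show ?thesis .
  qed
  then show "\<forall>\<^sub>F t in sequentially. expectation (\<lambda>\<omega>. (f t \<omega> + g t \<omega>)\<^sup>2) \<le> ?h t"
    by simp
qed simp_all

lemma ms_null_scale:
  assumes "ms_null f"
  shows "ms_null (\<lambda>t \<omega>. r * f t \<omega>)"
  using tendsto_mult_left[OF assms[unfolded ms_null_def], of "r\<^sup>2"]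
  by (simp add: ms_null_def power_mult_distrib)

lemma ms_null_sum:
  assumes "\<And>j t. j \<in> J \<Longrightarrow> L2_past t (f j t)" "\<And>j. j \<in> J \<Longrightarrow> ms_null (f j)"
  shows "ms_null (\<lambda>t \<omega>. \<Sum>j\<in>J. f j t \<omega>)"
  using assms
proof (induction J rule: infinite_finite_induct)
  case (insert j J)
  then have "ms_null (\<lambda>t \<omega>. f j t \<omega> + (\<Sum>j\<in>J. f j t \<omega>))"
    by (intro ms_null_add L2_past_sum) auto
  then show ?case using insert.hyps by simp
qed (simp_all add: ms_null_def)

lemma ms_null_delay:
  "ms_null (\<lambda>t. \<upsilon> (int t)) \<Longrightarrow> ms_null (\<lambda>t. \<upsilon> (int t - int j))"
  unfolding ms_null_def
  by (rule LIMSEQ_offset[where k=j]) simp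

lemma energy_tendsto_0:
  assumes chan: "scalar_channel \<alpha> \<gamma> \<beta> \<delta> D \<xi> \<upsilon>"
    and null: "ms_null \<xi>" "ms_null (\<lambda>t. \<upsilon> (int t))"
  shows "energy \<alpha> \<beta> \<delta> D \<xi> \<upsilon> \<longlonglongrightarrow> 0"
proof -
  have "ms_null (predictor \<alpha> \<beta> D \<xi> \<upsilon>)"
    unfolding predictor_def[abs_def]
    by (intro ms_null_add ms_null_sum ms_null_scale ms_null_delay null
        L2_past_sum L2_past_scale scalar_channel_input_L2[OF chan])
      (use chan in \<open>auto simp: scalar_channel_def\<close>)
  moreover have "ms_null (\<lambda>t. \<upsilon> (int t - int j))" for j
    by (rule ms_null_delay[OF null(2)])
  ultimately have "(\<lambda>t. energy \<alpha> \<beta> \<delta> D \<xi> \<upsilon> t) \<longlonglongrightarrow>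
      0 + (\<alpha>\<^sup>2) ^ D * \<sigma>D\<^sup>2 * \<delta>\<^sup>2 * (\<Sum>j=1..D. 0)"
    unfolding energy_def ms_null_def by (intro tendsto_intros)
  then show ?thesis by simp
qed

lemma energy_nonneg: "0 \<le> energy \<alpha> \<beta> \<delta> D \<xi> \<upsilon> t"
  by (auto simp: energy_def intro!: add_nonneg_nonneg mult_nonneg_nonneg sum_nonneg)

section \<open>The sign of the energy increment\<close>

text \<open>After multiplication by \<open>\<beta>\<^sup>2 + m > 0\<close> and completion of the square, the quadratic form is a
  square plus \<open>((\<alpha>\<^sup>2 - 1) m - \<beta>\<^sup>2) \<zeta>\<^sup>2\<close>, so above the bound no input can lower the energy.\<close>

lemma energy_mono:
  assumes chan: "scalar_channel \<alpha> \<gamma> \<beta> \<delta> D \<xi> \<upsilon>" and "\<beta> \<noteq> 0"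
    and ge: "\<beta>\<^sup>2 \<le> (\<alpha>\<^sup>2 - 1) * ((\<alpha>\<^sup>2) ^ D * (\<sigma>0\<^sup>2 * \<gamma>\<^sup>2 + \<sigma>D\<^sup>2 * \<delta>\<^sup>2))"
  shows "energy \<alpha> \<beta> \<delta> D \<xi> \<upsilon> t \<le> energy \<alpha> \<beta> \<delta> D \<xi> \<upsilon> (Suc t)"
proof -
  define m where "m = (\<alpha>\<^sup>2) ^ D * (\<sigma>0\<^sup>2 * \<gamma>\<^sup>2 + \<sigma>D\<^sup>2 * \<delta>\<^sup>2)"
  have "0 \<le> m" by (simp add: m_def)
  with \<open>\<beta> \<noteq> 0\<close> have pos: "0 < \<beta>\<^sup>2 + m" by (simp add: add_pos_nonneg)
  have "0 \<le> (\<alpha> * z + \<beta> * v)\<^sup>2 + m * v\<^sup>2 - z\<^sup>2" for z v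
  proof -
    have "0 \<le> ((\<beta>\<^sup>2 + m) * v + \<alpha> * \<beta> * z)\<^sup>2 + ((\<alpha>\<^sup>2 - 1) * m - \<beta>\<^sup>2) * z\<^sup>2"
      using ge by (simp add: m_def)
    also have "\<dots> = (\<beta>\<^sup>2 + m) * ((\<alpha> * z + \<beta> * v)\<^sup>2 + m * v\<^sup>2 - z\<^sup>2)"
      by algebra
    finally show ?thesis using pos by (simp add: zero_le_mult_iff)
  qed
  then have "0 \<le> energy \<alpha> \<beta> \<delta> D \<xi> \<upsilon> (Suc t) - energy \<alpha> \<beta> \<delta> D \<xi> \<upsilon> t"
    unfolding energy_balance[OF chan] m_def by (intro integral_nonneg_AE) simp
  then show ?thesis by simp
qed

text \<open>The gain \<open>k\<close> is the minimizer of the quadratic form, whose value then is \<open>(\<rho> - 1) \<zeta>\<^sup>2\<close> with \<open>\<rho> < 1\<close>.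
  The energy decrements telescope, and their sum is bounded by the initial energy.\<close>

lemma predictive_feedback:
  fixes \<alpha> \<beta> \<gamma> \<delta> :: real and D :: nat
  defines "m \<equiv> (\<alpha>\<^sup>2) ^ D * (\<sigma>0\<^sup>2 * \<gamma>\<^sup>2 + \<sigma>D\<^sup>2 * \<delta>\<^sup>2)"
  defines "k \<equiv> - (\<alpha> * \<beta> / (\<beta>\<^sup>2 + m))"
  assumes chan: "scalar_channel \<alpha> \<gamma> \<beta> \<delta> D \<xi> \<upsilon>" and "\<alpha> \<noteq> 0" "\<beta> \<noteq> 0"
    and less: "(\<alpha>\<^sup>2 - 1) * m < \<beta>\<^sup>2"
    and fb: "\<And>t \<omega>. \<omega> \<in> space M \<Longrightarrow> \<upsilon> (int t) \<omega> = k * predictor \<alpha> \<beta> D \<xi> \<upsilon> t \<omega>"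
  shows "summable (\<lambda>t. expectation (\<lambda>\<omega>. (\<upsilon> (int t) \<omega>)\<^sup>2))" and "ms_null \<xi>"
proof -
  let ?z = "predictor \<alpha> \<beta> D \<xi> \<upsilon>"
  let ?Z = "\<lambda>t. expectation (\<lambda>\<omega>. (?z t \<omega>)\<^sup>2)"
  have z: "L2_past t (?z t)" for t by (rule predictor_L2[OF chan])
  have "0 \<le> m" by (simp add: m_def)
  with \<open>\<beta> \<noteq> 0\<close> have pos: "0 < \<beta>\<^sup>2 + m" by (simp add: add_pos_nonneg)
  define \<rho> where "\<rho> = \<alpha>\<^sup>2 * m / (\<beta>\<^sup>2 + m)"
  have "\<rho> < 1" using less pos by (simp add: \<rho>_def field_simps)
  have quad: "(\<alpha> * z + \<beta> * (k * z))\<^sup>2 + m * (k * z)\<^sup>2 - z\<^sup>2 = (\<rho> - 1) * z\<^sup>2" for z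
  proof -
    have "(\<beta>\<^sup>2 + m) * k = - (\<alpha> * \<beta>)" "(\<beta>\<^sup>2 + m) * \<rho> = \<alpha>\<^sup>2 * m"
      using pos by (simp_all add: k_def \<rho>_def)
    then have "(\<beta>\<^sup>2 + m) * ((\<alpha> * z + \<beta> * (k * z))\<^sup>2 + m * (k * z)\<^sup>2 - z\<^sup>2)
        = (\<beta>\<^sup>2 + m) * ((\<rho> - 1) * z\<^sup>2)"
      by algebra
    then show ?thesis using pos by simp
  qed
  have decrease: "energy \<alpha> \<beta> \<delta> D \<xi> \<upsilon> (Suc t) = energy \<alpha> \<beta> \<delta> D \<xi> \<upsilon> t - (1 - \<rho>) * ?Z t" for t
  proof -
    have "energy \<alpha> \<beta> \<delta> D \<xi> \<upsilon> (Suc t) - energy \<alpha> \<beta> \<delta> D \<xi> \<upsilon> t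
        = expectation (\<lambda>\<omega>. (\<rho> - 1) * (?z t \<omega>)\<^sup>2)"
      unfolding energy_balance[OF chan] m_def[symmetric]
      by (rule Bochner_Integration.integral_cong) (simp_all add: fb quad)
    also have "\<dots> = (\<rho> - 1) * ?Z t"
      by (rule integral_mult_right_zero)
    finally show ?thesis by (simp add: left_diff_distrib)
  qed
  have telescope: "(\<Sum>t<n. (1 - \<rho>) * ?Z t) = energy \<alpha> \<beta> \<delta> D \<xi> \<upsilon> 0 - energy \<alpha> \<beta> \<delta> D \<xi> \<upsilon> n" for n
    by (induction n) (simp_all add: decrease)
  have "summable (\<lambda>t. (1 - \<rho>) * ?Z t)"
  proof (rule bounded_imp_summable)
    show "0 \<le> (1 - \<rho>) * ?Z t" for t using \<open>\<rho> < 1\<close> by simp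
    show "(\<Sum>t\<le>n. (1 - \<rho>) * ?Z t) \<le> energy \<alpha> \<beta> \<delta> D \<xi> \<upsilon> 0" for n
      using telescope[of "Suc n"] energy_nonneg[of \<alpha> \<beta> \<delta> D \<xi> \<upsilon> "Suc n"]
      by (simp add: lessThan_Suc_atMost)
  qed
  then have Z: "summable ?Z" using \<open>\<rho> < 1\<close> by (simp add: summable_mult_D)
  have "(\<lambda>t. expectation (\<lambda>\<omega>. (\<upsilon> (int t) \<omega>)\<^sup>2)) = (\<lambda>t. k\<^sup>2 * ?Z t)"
  proof
    fix t
    have "expectation (\<lambda>\<omega>. (\<upsilon> (int t) \<omega>)\<^sup>2) = expectation (\<lambda>\<omega>. k\<^sup>2 * (?z t \<omega>)\<^sup>2)"
      by (rule Bochner_Integration.integral_cong) (simp_all add: fb power_mult_distrib)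
    then show "expectation (\<lambda>\<omega>. (\<upsilon> (int t) \<omega>)\<^sup>2) = k\<^sup>2 * ?Z t" by simp
  qed
  then show sum: "summable (\<lambda>t. expectation (\<lambda>\<omega>. (\<upsilon> (int t) \<omega>)\<^sup>2))"
    using Z by (simp add: summable_mult)
  have "ms_null (\<lambda>t. \<upsilon> (int t))" "ms_null ?z"
    using summable_LIMSEQ_zero[OF sum] summable_LIMSEQ_zero[OF Z] by (simp_all add: ms_null_def)
  then have "ms_null (\<lambda>t \<omega>. (1 / \<alpha> ^ D) * (?z t \<omega>
      + (\<Sum>j=1..D. (- (\<alpha> ^ (j - 1) * \<beta>)) * \<upsilon> (int t - int j) \<omega>)))"
    by (intro ms_null_add ms_null_sum ms_null_scale ms_null_delay z
        L2_past_sum L2_past_scale scalar_channel_input_L2[OF chan]) auto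
  \<comment> \<open>Solving the definition of the predictor for the state.\<close>
  moreover have "(\<lambda>t \<omega>. (1 / \<alpha> ^ D) * (?z t \<omega>
      + (\<Sum>j=1..D. (- (\<alpha> ^ (j - 1) * \<beta>)) * \<upsilon> (int t - int j) \<omega>))) = \<xi>"
    using \<open>\<alpha> \<noteq> 0\<close> by (intro ext) (simp add: predictor_def sum_negf)
  ultimately show "ms_null \<xi>" by simp
qed

section \<open>Stabilizability for a fixed delay\<close>

text \<open>Only the \<open>i\<close>-th coordinate is observed, and only the run from the \<open>i\<close>-th unit vector with zero
  initial inputs: its energy starts at \<open>a\<^sub>i^(2D) > 0\<close> and must tend to \<open>0\<close>, which a nondecreasing
  sequence cannot do.\<close>

lemma stabilizable_imp_gain_bound:
  fixes a c b cD :: "real ^ 'n"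
  assumes stab: "ms_stabilizable M w0 wD (diag_mat a) (diag_mat c) (diag_mat b) (diag_mat cD) D"
    and nz: "a $ i \<noteq> 0" "b $ i \<noteq> 0"
  shows "((a $ i)\<^sup>2 - 1) * (((a $ i)\<^sup>2) ^ D * (\<sigma>0\<^sup>2 * (c $ i)\<^sup>2 + \<sigma>D\<^sup>2 * (cD $ i)\<^sup>2)) < (b $ i)\<^sup>2"
proof (rule ccontr)
  assume "\<not> ?thesis"
  then have ge: "(b $ i)\<^sup>2 \<le> ((a $ i)\<^sup>2 - 1) * (((a $ i)\<^sup>2) ^ D * (\<sigma>0\<^sup>2 * (c $ i)\<^sup>2 + \<sigma>D\<^sup>2 * (cD $ i)\<^sup>2))"
    by simp
  obtain K where K: "\<And>x0 \<phi> x u. closed_loop M w0 wD (diag_mat a) (diag_mat c) (diag_mat b)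
        (diag_mat cD) D K x0 \<phi> x u \<Longrightarrow>
      admissible M w0 wD D x u \<and> (\<forall>t. integrable M (\<lambda>\<omega>. x t \<omega> \<bullet> x t \<omega>)) \<and>
      (\<lambda>t. expectation (\<lambda>\<omega>. x t \<omega> \<bullet> x t \<omega>)) \<longlonglongrightarrow> 0"
    using stab unfolding ms_stabilizable_def by blast
  obtain x u where loop: "closed_loop M w0 wD (diag_mat a) (diag_mat c) (diag_mat b) (diag_mat cD)
      D K (axis i 1) (\<lambda>_. 0) x u"
    using closed_loop_exists by blast
  define \<xi> \<upsilon> where "\<xi> = (\<lambda>t \<omega>. x t \<omega> $ i)" and "\<upsilon> = (\<lambda>s \<omega>. u s \<omega> $ i)"
  have chan: "scalar_channel (a $ i) (c $ i) (b $ i) (cD $ i) D \<xi> \<upsilon>"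
    unfolding \<xi>_def \<upsilon>_def by (rule closed_loop_scalar_channel[OF loop])
  let ?Y = "energy (a $ i) (b $ i) (cD $ i) D \<xi> \<upsilon>"
  have nth_sq: "(v $ i)\<^sup>2 \<le> v \<bullet> v" for v :: "real ^ 'n"
    unfolding inner_vec_def power2_eq_square inner_real_def by (rule member_le_sum) auto
  have "admissible M w0 wD D x u" using K[OF loop] by simp
  then have int_u: "\<And>t. integrable M (\<lambda>\<omega>. u (int t) \<omega> \<bullet> u (int t) \<omega>)"
    and lim_u: "(\<lambda>t. expectation (\<lambda>\<omega>. u (int t) \<omega> \<bullet> u (int t) \<omega>)) \<longlonglongrightarrow> 0"
    by (auto simp: admissible_def intro: summable_LIMSEQ_zero)
  have "ms_null \<xi>" unfolding ms_null_def
  proof (rule tendsto_sandwich[OF _ _ tendsto_const])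
    show "(\<lambda>t. expectation (\<lambda>\<omega>. x t \<omega> \<bullet> x t \<omega>)) \<longlonglongrightarrow> 0" using K[OF loop] by simp
    show "\<forall>\<^sub>F t in sequentially. expectation (\<lambda>\<omega>. (\<xi> t \<omega>)\<^sup>2) \<le> expectation (\<lambda>\<omega>. x t \<omega> \<bullet> x t \<omega>)"
      using K[OF loop] chan
      by (intro always_eventually allI integral_mono)
        (auto simp: \<xi>_def nth_sq scalar_channel_def L2_past_def)
  qed simp
  moreover have "ms_null (\<lambda>t. \<upsilon> (int t))" unfolding ms_null_def
  proof (rule tendsto_sandwich[OF _ _ tendsto_const lim_u])
    show "\<forall>\<^sub>F t in sequentially.
        expectation (\<lambda>\<omega>. (\<upsilon> (int t) \<omega>)\<^sup>2) \<le> expectation (\<lambda>\<omega>. u (int t) \<omega> \<bullet> u (int t) \<omega>)"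
      using int_u L2_past_integrable_square[OF scalar_channel_input_L2[OF chan, of 0]]
      by (intro always_eventually allI integral_mono) (auto simp: \<upsilon>_def nth_sq)
  qed simp
  ultimately have "?Y \<longlonglongrightarrow> 0" by (rule energy_tendsto_0[OF chan])
  moreover have "incseq ?Y"
    using energy_mono[OF chan nz(2) ge] by (intro incseq_SucI)
  ultimately have "?Y 0 \<le> 0" by (metis incseq_le)
  moreover have "0 < ?Y 0"
  proof -
    have init: "\<xi> 0 \<omega> = 1" "j \<in> {1..D} \<Longrightarrow> \<upsilon> (- int j) \<omega> = 0" if "\<omega> \<in> space M" for \<omega> j
      using loop that by (auto simp: closed_loop_def initial_data_def \<xi>_def \<upsilon>_def)
    have "expectation (\<lambda>\<omega>. (predictor (a $ i) (b $ i) D \<xi> \<upsilon> 0 \<omega>)\<^sup>2) = expectation (\<lambda>\<omega>. ((a $ i) ^ D)\<^sup>2)"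
      by (rule Bochner_Integration.integral_cong) (simp_all add: predictor_def init)
    also have "\<dots> = ((a $ i) ^ D)\<^sup>2" by (simp add: prob_space)
    also have "\<dots> > 0" using nz by simp
    finally show ?thesis
      unfolding energy_def by (intro add_pos_nonneg) (auto intro!: mult_nonneg_nonneg sum_nonneg)
  qed
  ultimately show False by simp
qed

text \<open>Diagonal gains implement \<open>u\<^sub>i = k\<^sub>i \<zeta>\<^sub>i\<close> in every coordinate, because the predictor is itself a
  linear combination of the current state and the last \<open>D\<close> inputs.\<close>

lemma gain_bound_imp_stabilizable:
  fixes a c b cD :: "real ^ 'n"
  assumes nz: "\<And>i. a $ i \<noteq> 0" "\<And>i. b $ i \<noteq> 0"
    and bound: "\<And>i. ((a $ i)\<^sup>2 - 1) * (((a $ i)\<^sup>2) ^ D *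
        (\<sigma>0\<^sup>2 * (c $ i)\<^sup>2 + \<sigma>D\<^sup>2 * (cD $ i)\<^sup>2)) < (b $ i)\<^sup>2"
  shows "ms_stabilizable M w0 wD (diag_mat a) (diag_mat c) (diag_mat b) (diag_mat cD) D"
proof -
  define k where "k i = - (a $ i * b $ i / ((b $ i)\<^sup>2
    + ((a $ i)\<^sup>2) ^ D * (\<sigma>0\<^sup>2 * (c $ i)\<^sup>2 + \<sigma>D\<^sup>2 * (cD $ i)\<^sup>2)))" for i
  define K where "K \<tau> = diag_mat (\<chi> i. k i *
    (if \<tau> = 0 then (a $ i) ^ D else (a $ i) ^ (\<tau> - 1) * b $ i))" for \<tau> :: nat
  have "admissible M w0 wD D x u \<and> (\<forall>t. integrable M (\<lambda>\<omega>. x t \<omega> \<bullet> x t \<omega>)) \<and>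
      (\<lambda>t. expectation (\<lambda>\<omega>. x t \<omega> \<bullet> x t \<omega>)) \<longlonglongrightarrow> 0"
    if loop: "closed_loop M w0 wD (diag_mat a) (diag_mat c) (diag_mat b) (diag_mat cD) D K x0 \<phi> x u"
    for x0 \<phi> x u
  proof -
    have law: "feedback_law M D K x u" using loop by (simp add: closed_loop_def)
    have "u (int t) \<omega> $ i = k i * predictor (a $ i) (b $ i) D (\<lambda>t \<omega>. x t \<omega> $ i) (\<lambda>s \<omega>. u s \<omega> $ i) t \<omega>"
      if "\<omega> \<in> space M" for t \<omega> i
      using law that
      by (simp add: feedback_law_def K_def predictor_def distrib_left sum_distrib_left mult.assoc)
    from predictive_feedback[OF closed_loop_scalar_channel[OF loop] nz bound, folded k_def, OF this]
    have u_sum: "\<And>i. summable (\<lambda>t. expectation (\<lambda>\<omega>. (u (int t) \<omega> $ i)\<^sup>2))"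
      and x_null: "\<And>i. ms_null (\<lambda>t \<omega>. x t \<omega> $ i)"
      by auto
    have L2: "L2_past t (\<lambda>\<omega>. x t \<omega> $ i)" "L2_past t (\<lambda>\<omega>. u (int t) \<omega> $ i)" for t i
      using closed_loop_L2_past[OF loop] closed_loop_L2_past(2)[OF loop, of "int t"] by auto
    have inner: "v \<bullet> v = (\<Sum>i\<in>UNIV. (v $ i)\<^sup>2)" for v :: "real ^ 'n"
      by (simp add: inner_vec_def power2_eq_square)
    have expand: "expectation (\<lambda>\<omega>. f \<omega> \<bullet> f \<omega>) = (\<Sum>i\<in>UNIV. expectation (\<lambda>\<omega>. (f \<omega> $ i)\<^sup>2))"
      "integrable M (\<lambda>\<omega>. f \<omega> \<bullet> f \<omega>)"
      if "\<And>i. L2_past t (\<lambda>\<omega>. f \<omega> $ i)" for f :: "'w \<Rightarrow> real ^ 'n" and t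
      unfolding inner using L2_past_integrable_square[OF that] by auto
    have "u (int t) \<in> borel_measurable (noise_filtration M w0 wD t)" for t
      unfolding past_Suc[symmetric]
    proof (subst borel_measurable_euclidean_space, intro ballI)
      fix e :: "real ^ 'n" assume "e \<in> Basis"
      then obtain i where "e = axis i 1" by (auto simp: Basis_vec_def)
      then show "(\<lambda>\<omega>. u (int t) \<omega> \<bullet> e) \<in> borel_measurable (past (Suc t))"
        using L2(2)[of t i] past_mono[of t "Suc t"] by (auto simp: inner_axis L2_past_def)
    qed
    moreover have "summable (\<lambda>t. expectation (\<lambda>\<omega>. u (int t) \<omega> \<bullet> u (int t) \<omega>))"
      unfolding expand(1)[OF L2(2)] by (intro summable_sum u_sum)
    ultimately have "admissible M w0 wD D x u"
      using law expand(2)[OF L2(2)] by (auto simp: admissible_def)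
    moreover have "(\<lambda>t. expectation (\<lambda>\<omega>. x t \<omega> \<bullet> x t \<omega>)) \<longlonglongrightarrow> (\<Sum>i\<in>(UNIV :: 'n set). 0)"
      unfolding expand(1)[OF L2(1)] using x_null unfolding ms_null_def by (intro tendsto_sum)
    ultimately show ?thesis using expand(2)[OF L2(1)] by simp
  qed
  then show ?thesis unfolding ms_stabilizable_def by blast
qed

end

section \<open>The delay margin\<close>

text \<open>Monotonicity of the logarithm. For \<open>s = 0\<close> both sides hold: \<open>ln 0 = -\<infinity>\<close> makes the quotient
  infinite.\<close>

lemma less_delay_quotient_iff:
  fixes \<alpha> \<beta> s :: real
  assumes "1 < \<alpha>\<^sup>2" "\<beta> \<noteq> 0" "0 \<le> s"
  shows "ereal (real D) < (eln (\<beta>\<^sup>2) - eln s - eln (\<alpha>\<^sup>2 - 1)) / eln (\<alpha>\<^sup>2) \<longleftrightarrow>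
    (\<alpha>\<^sup>2 - 1) * ((\<alpha>\<^sup>2) ^ D * s) < \<beta>\<^sup>2"
proof (cases "s = 0")
  case True
  have "0 < ln (\<alpha>\<^sup>2)" by (rule ln_gt_zero) (rule assms)
  moreover have "\<alpha> \<noteq> 0" using assms(1) by auto
  ultimately show ?thesis using assms True by (simp add: eln_def)
next
  case False
  have pos: "0 < s" "0 < \<alpha>\<^sup>2 - 1" "0 < ln (\<alpha>\<^sup>2)" "0 < \<alpha>\<^sup>2" "0 < \<beta>\<^sup>2"
    using assms False ln_gt_zero[OF assms(1)] by auto
  have "ereal (real D) < (eln (\<beta>\<^sup>2) - eln s - eln (\<alpha>\<^sup>2 - 1)) / eln (\<alpha>\<^sup>2) \<longleftrightarrow>
      real D < (ln (\<beta>\<^sup>2) - ln s - ln (\<alpha>\<^sup>2 - 1)) / ln (\<alpha>\<^sup>2)"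
    using pos by (simp add: eln_def)
  also have "\<dots> \<longleftrightarrow> ln (\<alpha>\<^sup>2 - 1) + (real D * ln (\<alpha>\<^sup>2) + ln s) < ln (\<beta>\<^sup>2)"
    using pos by (simp add: less_divide_eq) linarith
  also have "ln (\<alpha>\<^sup>2 - 1) + (real D * ln (\<alpha>\<^sup>2) + ln s) = ln ((\<alpha>\<^sup>2 - 1) * ((\<alpha>\<^sup>2) ^ D * s))"
    using pos by (simp add: ln_mult ln_realpow)
  also have "\<dots> < ln (\<beta>\<^sup>2) \<longleftrightarrow> (\<alpha>\<^sup>2 - 1) * ((\<alpha>\<^sup>2) ^ D * s) < \<beta>\<^sup>2"
    using pos by (intro ln_less_cancel_iff) auto
  finally show ?thesis .
qed

lemma less_gain_ratio_iff:
  fixes \<alpha> \<beta> s :: real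
  assumes "\<beta> \<noteq> 0" "0 \<le> s"
  shows "ereal (\<alpha>\<^sup>2) < ereal (\<beta>\<^sup>2) / ereal s + 1 \<longleftrightarrow> (\<alpha>\<^sup>2 - 1) * s < \<beta>\<^sup>2"
proof (cases "s = 0")
  case True
  then show ?thesis using assms by (simp add: divide_ereal_def one_ereal_def)
next
  case False
  then show ?thesis using assms by (simp add: one_ereal_def field_simps)
qed

text \<open>If \<open>v\<^sub>i = 0\<close>, the \<open>i\<close>-th unit vector lies in the kernel.\<close>

lemma diag_mat_invertible_nth:
  fixes v :: "real ^ 'n"
  assumes "invertible (diag_mat v)"
  shows "v $ i \<noteq> 0"
proof
  assume "v $ i = 0"
  then have "diag_mat v *v axis i 1 = 0"
    by (auto simp: vec_eq_iff axis_def)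
  moreover obtain B where "B ** diag_mat v = mat 1"
    using assms unfolding invertible_def by blast
  then have "B *v (diag_mat v *v axis i 1) = axis i 1"
    by (simp add: matrix_vector_mul_assoc)
  ultimately have "axis i (1 :: real) = 0" by simp
  then show False by (simp add: axis_eq_0_iff)
qed

theorem theorem4:
  fixes M :: "'w measure"
    and w0 wD :: "nat \<Rightarrow> 'w \<Rightarrow> real"
    and \<sigma>0 \<sigma>D :: real
    and a c b cD :: "real ^ 'n"
  assumes "prob_space M"
    and "iid_noise M w0 \<sigma>0"
    and "iid_noise M wD \<sigma>D"
    and "independent_sequences M w0 wD"
    and "invertible (diag_mat a)"
    and "\<forall>j. b $ j \<noteq> 0"
    and "\<exists>i. (a $ i)\<^sup>2 \<ge> 1"
  shows "\<exists>Dmax :: ereal.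
    (\<forall>D :: nat. ms_stabilizable M w0 wD (diag_mat a) (diag_mat c) (diag_mat b) (diag_mat cD) D
        \<longleftrightarrow> ereal (real D) < Dmax) \<and>
    ((\<forall>i\<in>unstable a. (a $ i)\<^sup>2 = 1) \<longrightarrow> Dmax = \<infinity>) \<and>
    ((\<forall>i\<in>unstable a. ereal ((a $ i)\<^sup>2) <
          ereal ((b $ i)\<^sup>2) / ereal (\<sigma>0\<^sup>2 * (c $ i)\<^sup>2 + \<sigma>D\<^sup>2 * (cD $ i)\<^sup>2) + 1) \<and>
      (\<exists>j\<in>unstable a. (a $ j)\<^sup>2 > 1) \<longrightarrow>
      Dmax = (MIN i\<in>{i\<in>unstable a. (a $ i)\<^sup>2 > 1}.
         (eln ((b $ i)\<^sup>2) - eln (\<sigma>0\<^sup>2 * (c $ i)\<^sup>2 + \<sigma>D\<^sup>2 * (cD $ i)\<^sup>2) - eln ((a $ i)\<^sup>2 - 1))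
           / eln ((a $ i)\<^sup>2))) \<and>
    ((\<exists>i\<in>unstable a. ereal ((a $ i)\<^sup>2) \<ge>
          ereal ((b $ i)\<^sup>2) / ereal (\<sigma>0\<^sup>2 * (c $ i)\<^sup>2 + \<sigma>D\<^sup>2 * (cD $ i)\<^sup>2) + 1) \<longrightarrow> Dmax = 0)"
proof -
  interpret two_channel_noise M w0 wD \<sigma>0 \<sigma>D
    using assms(1-4) by (simp add: two_channel_noise_def two_channel_noise_axioms_def)
  have nz: "a $ i \<noteq> 0" "b $ i \<noteq> 0" for i
    using assms(5,6) diag_mat_invertible_nth by auto
  let ?stab = "ms_stabilizable M w0 wD (diag_mat a) (diag_mat c) (diag_mat b) (diag_mat cD)"
  define s where "s i = \<sigma>0\<^sup>2 * (c $ i)\<^sup>2 + \<sigma>D\<^sup>2 * (cD $ i)\<^sup>2" for i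
  define q where "q i = (eln ((b $ i)\<^sup>2) - eln (s i) - eln ((a $ i)\<^sup>2 - 1)) / eln ((a $ i)\<^sup>2)" for i
  define V where "V = {i \<in> unstable a. (a $ i)\<^sup>2 > 1}"
  have s_nonneg: "0 \<le> s i" for i by (simp add: s_def)
  have stab_iff: "?stab D \<longleftrightarrow> (\<forall>i\<in>V. ((a $ i)\<^sup>2 - 1) * (((a $ i)\<^sup>2) ^ D * s i) < (b $ i)\<^sup>2)" for D
  proof
    assume "?stab D"
    then show "\<forall>i\<in>V. ((a $ i)\<^sup>2 - 1) * (((a $ i)\<^sup>2) ^ D * s i) < (b $ i)\<^sup>2"
      unfolding s_def using stabilizable_imp_gain_bound[OF _ nz] by blast
  next
    assume V: "\<forall>i\<in>V. ((a $ i)\<^sup>2 - 1) * (((a $ i)\<^sup>2) ^ D * s i) < (b $ i)\<^sup>2"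
    have "((a $ i)\<^sup>2 - 1) * (((a $ i)\<^sup>2) ^ D * s i) < (b $ i)\<^sup>2" for i
    proof (cases "i \<in> V")
      case False
      then have "(a $ i)\<^sup>2 - 1 \<le> 0" by (auto simp: V_def unstable_def)
      then have "((a $ i)\<^sup>2 - 1) * (((a $ i)\<^sup>2) ^ D * s i) \<le> 0"
        using s_nonneg by (intro mult_nonpos_nonneg) auto
      also have "0 < (b $ i)\<^sup>2" using nz by simp
      finally show ?thesis .
    qed (use V in simp)
    then show "?stab D"
      by (intro gain_bound_imp_stabilizable nz) (simp add: s_def)
  qed
  have quotient: "ereal (real D) < q i \<longleftrightarrow> ((a $ i)\<^sup>2 - 1) * (((a $ i)\<^sup>2) ^ D * s i) < (b $ i)\<^sup>2"
    if "i \<in> V" for D i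
    using that nz s_nonneg unfolding q_def by (intro less_delay_quotient_iff) (auto simp: V_def)
  have ratio: "ereal ((a $ i)\<^sup>2) < ereal ((b $ i)\<^sup>2) / ereal (s i) + 1 \<longleftrightarrow>
      ((a $ i)\<^sup>2 - 1) * s i < (b $ i)\<^sup>2" for i
    using nz s_nonneg by (intro less_gain_ratio_iff)
  define small where "small \<longleftrightarrow> (\<forall>i\<in>unstable a. ereal ((a $ i)\<^sup>2) < ereal ((b $ i)\<^sup>2) / ereal (s i) + 1)"
  define Dmax where "Dmax = (if V = {} then \<infinity> else if small then MIN i\<in>V. q i else 0)"
  have V_empty: "(\<forall>i\<in>unstable a. (a $ i)\<^sup>2 = 1) \<longleftrightarrow> V = {}"
    by (auto simp: V_def unstable_def)
  have small_if_empty: "small" if "V = {}"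
    unfolding small_def ratio using that nz V_empty by simp
  \<comment> \<open>A coordinate that fails the bound at delay \<open>0\<close> has \<open>a\<^sub>i\<^sup>2 > 1\<close>, as \<open>b\<^sub>i \<noteq> 0\<close>; then the factor
     \<open>a\<^sub>i^(2D) \<ge> 1\<close> makes it fail for every delay.\<close>
  have large: "\<not> ?stab D" if "\<not> small" for D
  proof -
    obtain i where i: "i \<in> unstable a" "(b $ i)\<^sup>2 \<le> ((a $ i)\<^sup>2 - 1) * s i"
      using \<open>\<not> small\<close> unfolding small_def ratio by (auto simp: not_less)
    have "0 < (b $ i)\<^sup>2" using nz by simp
    with i have "0 < ((a $ i)\<^sup>2 - 1) * s i" by linarith
    then have gt: "1 < (a $ i)\<^sup>2" using s_nonneg[of i] by (auto simp: zero_less_mult_iff)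
    then have "1 * (((a $ i)\<^sup>2 - 1) * s i) \<le> ((a $ i)\<^sup>2) ^ D * (((a $ i)\<^sup>2 - 1) * s i)"
      using s_nonneg less_imp_le[OF gt]
      by (intro mult_right_mono one_le_power[OF less_imp_le[OF gt]]) simp_all
    with i(2) have "(b $ i)\<^sup>2 \<le> ((a $ i)\<^sup>2 - 1) * (((a $ i)\<^sup>2) ^ D * s i)"
      by (simp add: mult_ac)
    with i gt show ?thesis by (auto simp: stab_iff V_def not_less)
  qed
  have "?stab D \<longleftrightarrow> ereal (real D) < Dmax" for D
  proof (cases "V = {}")
    case True
    then show ?thesis by (simp add: stab_iff Dmax_def)
  next
    case False
    then show ?thesis
      using large by (auto simp: Dmax_def stab_iff quotient)
  qed
  moreover have "(\<forall>i\<in>unstable a. (a $ i)\<^sup>2 = 1) \<longrightarrow> Dmax = \<infinity>"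
    by (simp add: V_empty Dmax_def)
  moreover have "small \<and> (\<exists>j\<in>unstable a. (a $ j)\<^sup>2 > 1) \<longrightarrow> Dmax = (MIN i\<in>V. q i)"
    by (auto simp: Dmax_def V_def)
  moreover have "(\<exists>i\<in>unstable a. ereal ((a $ i)\<^sup>2) \<ge> ereal ((b $ i)\<^sup>2) / ereal (s i) + 1) \<longrightarrow> Dmax = 0"
  proof
    assume "\<exists>i\<in>unstable a. ereal ((a $ i)\<^sup>2) \<ge> ereal ((b $ i)\<^sup>2) / ereal (s i) + 1"
    then have "\<not> small" unfolding small_def by (meson not_less)
    then show "Dmax = 0" using small_if_empty by (auto simp: Dmax_def)
  qed
  ultimately show ?thesis
    unfolding small_def q_def V_def s_def by (intro exI[of _ Dmax] conjI) blast+
qed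

end
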